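(* Let $q$ be a prime power and $n\geq 1$. Then: (i) Let $\chi$ be an irreducible character of $H(n+1,q)$ and $X,Y\in A_q(n+1)$ with $X\sim Y$. Then $p(\chi)(X)$ is a nonzero multiple of $p(\chi)(Y)$. (ii) Let $\chi$ be an irreducible character of $H(n+1,q)$. Then for $1\leq k\leq n+1$, the set $\{p(\chi)(\widehat{X}) : X\in B_q(n)_{k-1},\ p(\chi)(\widehat{X})\neq 0\}$ is a basis of $W(\chi)_k$. (iii) Let $\chi$ be an irreducible character of $H(n+1,q)$ and $X,Y\in B_q(n)$ with $X$ covering $Y$. If $p(\chi)(\widehat{X})\neq0$ then $p(\chi)(\widehat{Y})\neq 0$. (iv) Define $\theta_n:V(B_q(n))\to W(0)$ by $\theta_n(X)=\sum_{Y\sim\widehat{X}}Y$ for $X\in B_q(n)$ (the sum over $Y\in A_q(n+1)$ with $Y\sim\widehat X$). Then $\theta_n$ is an isomorphism of pairs $(V(B_q(n)),qU_n)$ and $(W(0),U_{n+1})$, and $$U_{n+1}(v)=U_n(v)+\theta_n(v)\quad (v\in V(B_q(n))),\qquad \langle\theta_n(w),\theta_n(v)\rangle=q^{n-k}\langle w,v\rangle\quad (w,v\in V(B_q(n)_k),\ 0\leq k\leq n).$$ (v) Let $\chi$ be a nontrivial irreducible character of $H(n+1,q)$. Then $\dim W(\chi)_n=1$ and there is a unique $X=X(\chi)\in B_q(n)_{n-1}$ with $p(\chi)(\widehat{X})\neq 0$. The linear map $\lambda(\chi):V(B_q(X))\to W(\chi)$ defined by $\lambda(\chi)(Y)=p(\chi)(\widehat{Y})$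 for $Y\in B_q(X)$ is an isomorphism of pairs $(V(B_q(X)),U_X)$ and $(W(\chi),U_{n+1})$, and satisfies $\langle\lambda(\chi)(w),\lambda(\chi)(v)\rangle=q^{n+k}\langle w,v\rangle$ for $w,v\in V(B_q(X)_k)$, $0\leq k\leq n-1$. (vi) For each $X\in B_q(n)_{n-1}$, the number of nontrivial irreducible characters $\chi$ of $H(n+1,q)$ with $p(\chi)(\widehat{X})\neq 0$ is $q-1$.
   Context: $\mathbb{F}_q^n$ is identified with the subspace of $\mathbb{F}_q^{n+1}$ of vectors with last coordinate $0$; $e_{n+1}$ is the last standard basis vector of $\mathbb{F}_q^{n+1}$. For a finite-dimensional $\mathbb{F}_q$-space $X$, $B_q(X)$ is the set of its subspaces (ordered by inclusion, graded by dimension, $B_q(X)_k$ the $k$-dimensional ones), $V(B_q(X))$ the complex vector space with basis $B_q(X)$ and standard inner product $\langle x,y\rangle=\delta(x,y)$, and $U_X$ the up operator $U_X(Y)=\sum Z$ over all $Z\in B_q(X)$ covering $Y$; we write $B_q(m)=B_q(\mathbb{F}_q^m)$, $U_m=U_{\mathbb{F}_q^m}$. $A_q(n+1)=B_q(n+1)\setminus B_q(n)$ (subspaces not contained in $\mathbb{F}_q^n$), $A_q(n+1)_k$ its $k$-dimensional members. For $X,Y\in A_q(n+1)$, $X\sim Y$ iff $X\cap\mathbb{F}_q^n=Y\cap\mathbb{F}_q^n$. For $X\in B_q(n)$, $\widehat{X}=\mathrm{span}(X\cup\{e_{n+1}\})\in A_q(n+1)$. $H(n+1,q)$ is the abelian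 subgroup of $GL(n+1,\mathbb{F}_q)$ of matrices $\begin{pmatrix} I & a\\ 0&1\end{pmatrix}$ ($a\in\mathbb{F}_q^n$), acting on $A_q(n+1)$ by left multiplication and linearly on $V(A_q(n+1))$; its irreducible characters all have degree $1$. For a character $\chi$, $p(\chi)(v)=\sum_{g\in H(n+1,q)}\overline{\chi(g)}\,gv$. $W(\chi)$ (resp. $W(\chi)_k$) is the isotypic component of $V(A_q(n+1))$ (resp. $V(A_q(n+1)_k)$) corresponding to $\chi$, and $W(0)$ denotes the isotypic component for the trivial character. An isomorphism of pairs $(V,f)$, $(W,g)$ is a linear isomorphism $\theta:V\to W$ with $\theta\circ f=g\circ\theta$. *)

theory Defs
  imports "Jordan_Normal_Form.VS_Connect" "HOL-Analysis.Analysis"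
begin

no_notation Matrix.vec_index (infixl "$" 100)

text \<open>
  Throughout, the field with \<open>q\<close> elements is a type \<open>'a :: {field, finite}\<close> with \<open>q = CARD('a)\<close>, and
  \<open>n = CARD('n)\<close>. The space of dimension \<open>n + 1\<close> is \<open>'a ^ 'n option\<close>; the index \<^term>\<open>None\<close> is the last
  coordinate.

  The free complex vector space on a finite set \<open>S\<close> of elements of a finite type \<open>'b\<close> is realised as
  the coordinate subspace of \<open>complex ^ 'b\<close> spanned by the standard basis vectors with index in \<open>S\<close>.
\<close>

section \<open>Free complex vector spaces\<close>

abbreviation bvec :: "'b::finite \<Rightarrow> complex ^ 'b" where
  "bvec Y \<equiv> axis Y 1"

definition free_space :: "'b::finite set \<Rightarrow> (complex ^ 'b) set" where
  "free_space S = vec.span (bvec ` S)"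

definition lin_ext :: "'b::finite set \<Rightarrow> ('b \<Rightarrow> complex ^ 'c) \<Rightarrow> complex ^ 'b \<Rightarrow> complex ^ 'c::finite" where
  \<comment> \<open>the linear map on \<^term>\<open>free_space S\<close> sending the basis vector of \<open>Y\<close> to \<open>f Y\<close>\<close>
  "lin_ext S f v = (\<Sum>Y\<in>S. v $ Y *s f Y)"

definition ip :: "complex ^ 'b \<Rightarrow> complex ^ 'b::finite \<Rightarrow> complex" where
  "ip v w = (\<Sum>Y\<in>UNIV. v $ Y * cnj (w $ Y))"

definition linear_map_on :: "(complex ^ 'b) set \<Rightarrow> (complex ^ 'b::finite \<Rightarrow> complex ^ 'c::finite) \<Rightarrow> bool" where
  "linear_map_on V f \<longleftrightarrow>
     (\<forall>u\<in>V. \<forall>v\<in>V. f (u + v) = f u + f v) \<and> (\<forall>c. \<forall>v\<in>V. f (c *s v) = c *s f v)"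

definition operator_on :: "(complex ^ 'b) set \<Rightarrow> (complex ^ 'b::finite \<Rightarrow> complex ^ 'b) \<Rightarrow> bool" where
  "operator_on V f \<longleftrightarrow> vec.subspace V \<and> linear_map_on V f \<and> f ` V \<subseteq> V"

definition pair_iso ::
  "(complex ^ 'b) set \<Rightarrow> (complex ^ 'b \<Rightarrow> complex ^ 'b) \<Rightarrow>
   (complex ^ 'c) set \<Rightarrow> (complex ^ 'c \<Rightarrow> complex ^ 'c) \<Rightarrow>
   (complex ^ 'b::finite \<Rightarrow> complex ^ 'c::finite) \<Rightarrow> bool" where
  "pair_iso V f W g \<theta> \<longleftrightarrow>
     operator_on V f \<and> operator_on W g \<and>
     linear_map_on V \<theta> \<and> bij_betw \<theta> V W \<and> (\<forall>v\<in>V. \<theta> (f v) = g (\<theta> v))"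


section \<open>Irreducible characters and isotypic components\<close>

definition matrix_rep :: "('g, 'r) monoid_scheme \<Rightarrow> nat \<Rightarrow> ('g \<Rightarrow> complex Matrix.mat) \<Rightarrow> bool" where
  "matrix_rep G d \<rho> \<longleftrightarrow>
     (\<forall>g\<in>carrier G. \<rho> g \<in> carrier_mat d d) \<and>
     \<rho> \<one>\<^bsub>G\<^esub> = 1\<^sub>m d \<and>
     (\<forall>g\<in>carrier G. \<forall>h\<in>carrier G. \<rho> (g \<otimes>\<^bsub>G\<^esub> h) = \<rho> g * \<rho> h)"

definition irreducible_matrix_rep ::
  "('g, 'r) monoid_scheme \<Rightarrow> nat \<Rightarrow> ('g \<Rightarrow> complex Matrix.mat) \<Rightarrow> bool" where
  "irreducible_matrix_rep G d \<rho> \<longleftrightarrow>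
     matrix_rep G d \<rho> \<and> d > 0 \<and>
     (\<forall>W. VectorSpace.subspace class_ring W (module_vec TYPE(complex) d) \<and>
          (\<forall>g\<in>carrier G. \<forall>w\<in>W. \<rho> g *\<^sub>v w \<in> W) \<longrightarrow>
          W = {0\<^sub>v d} \<or> W = carrier_vec d)"

text \<open>Characters are extensional functions on the carrier, so that distinct characters are distinct
  as functions and can be counted.\<close>

definition irr_chars :: "('g, 'r) monoid_scheme \<Rightarrow> ('g \<Rightarrow> complex) set" where
  "irr_chars G =
     {(\<lambda>g\<in>carrier G. \<Sum>i<d. \<rho> g $$ (i, i)) | d \<rho>. irreducible_matrix_rep G d \<rho>}"

definition trivial_char :: "('g, 'r) monoid_scheme \<Rightarrow> 'g \<Rightarrow> complex" where
  "trivial_char G = (\<lambda>g\<in>carrier G. 1)"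

definition trace_on :: "(complex ^ 'b) set \<Rightarrow> (complex ^ 'b::finite \<Rightarrow> complex ^ 'b) \<Rightarrow> complex" where
  "trace_on S f =
     (let B = (SOME B. vec.independent B \<and> vec.span B = S)
      in \<Sum>b\<in>B. vec.representation B (f b) b)"

definition irreducible_submodule ::
  "('g, 'r) monoid_scheme \<Rightarrow> ('g \<Rightarrow> complex ^ 'b::finite \<Rightarrow> complex ^ 'b) \<Rightarrow> (complex ^ 'b) set \<Rightarrow> bool" where
  "irreducible_submodule G act S \<longleftrightarrow>
     vec.subspace S \<and> S \<noteq> {0} \<and> (\<forall>g\<in>carrier G. act g ` S \<subseteq> S) \<and>
     (\<forall>T. vec.subspace T \<and> T \<subseteq> S \<and> (\<forall>g\<in>carrier G. act g ` T \<subseteq> T) \<longrightarrow> T = {0} \<or> T = S)"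

definition isotypic ::
  "('g, 'r) monoid_scheme \<Rightarrow> ('g \<Rightarrow> complex ^ 'b::finite \<Rightarrow> complex ^ 'b) \<Rightarrow>
   (complex ^ 'b) set \<Rightarrow> ('g \<Rightarrow> complex) \<Rightarrow> (complex ^ 'b) set" where
  \<comment> \<open>the sum of all irreducible submodules of \<open>M\<close> with character \<open>\<psi>\<close>\<close>
  "isotypic G act M \<psi> =
     vec.span (\<Union>{S. S \<subseteq> M \<and> irreducible_submodule G act S \<and>
                     (\<forall>g\<in>carrier G. trace_on S (act g) = \<psi> g)})"


section \<open>Subspace lattices\<close>

definition Bq :: "('a::{field,finite} ^ 'm::finite) set \<Rightarrow> ('a ^ 'm) set set" where
  "Bq X = {Y. vec.subspace Y \<and> Y \<subseteq> X}"

definition rank_part :: "('a::{field,finite} ^ 'm::finite) set set \<Rightarrow> nat \<Rightarrow> ('a ^ 'm) set set" where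
  "rank_part P k = {Y \<in> P. vec.dim Y = k}"

definition covers_in :: "'b set set \<Rightarrow> 'b set \<Rightarrow> 'b set \<Rightarrow> bool" where
  \<comment> \<open>\<open>Z\<close> covers \<open>Y\<close> in the family \<open>P\<close> ordered by inclusion\<close>
  "covers_in P Z Y \<longleftrightarrow> Y \<in> P \<and> Z \<in> P \<and> Y \<subset> Z \<and> \<not> (\<exists>W\<in>P. Y \<subset> W \<and> W \<subset> Z)"

definition up_op ::
  "('a::{field,finite} ^ 'm::finite) set \<Rightarrow> complex ^ (('a ^ 'm) set) \<Rightarrow> complex ^ (('a ^ 'm) set)" where
  "up_op X = lin_ext (Bq X) (\<lambda>Y. \<Sum>Z | covers_in (Bq X) Z Y. bvec Z)"

definition Fqn :: "('a::{field,finite} ^ 'n::finite option) set" where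
  "Fqn = {v. v $ None = 0}"

definition Aq :: "('a::{field,finite} ^ 'n::finite option) set set" where
  "Aq = Bq UNIV - Bq Fqn"

definition Aq_equiv ::
  "('a::{field,finite} ^ 'n::finite option) set \<Rightarrow> ('a ^ 'n option) set \<Rightarrow> bool" where
  "Aq_equiv X Y \<longleftrightarrow> X \<inter> Fqn = Y \<inter> Fqn"

definition hat :: "('a::{field,finite} ^ 'n::finite option) set \<Rightarrow> ('a ^ 'n option) set" where
  "hat X = vec.span (X \<union> {axis None 1})"


section \<open>The group of translations and its action\<close>

definition GL_group :: "('a::field ^ 'm::finite ^ 'm) monoid" where
  "GL_group = \<lparr>carrier = {M. invertible M}, monoid.mult = (**), one = Finite_Cartesian_Product.mat 1\<rparr>"

definition H_mat :: "'a::{field,finite} ^ 'n::finite \<Rightarrow> 'a ^ 'n option ^ 'n option" where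
  "H_mat a = (\<chi> i j. case (i, j) of
       (Some i', Some j') \<Rightarrow> if i' = j' then 1 else 0
     | (Some i', None) \<Rightarrow> a $ i'
     | (None, Some j') \<Rightarrow> 0
     | (None, None) \<Rightarrow> 1)"

definition H_group :: "('a::{field,finite} ^ 'n::finite option ^ 'n option) monoid" where
  "H_group = GL_group\<lparr>carrier := range H_mat\<rparr>"

definition H_act ::
  "'a::{field,finite} ^ 'n::finite option ^ 'n option \<Rightarrow>
   complex ^ (('a ^ 'n option) set) \<Rightarrow> complex ^ (('a ^ 'n option) set)" where
  "H_act g = lin_ext Aq (\<lambda>X. bvec ((\<lambda>x. g *v x) ` X))"

definition char_proj ::
  "('a::{field,finite} ^ 'n::finite option ^ 'n option \<Rightarrow> complex) \<Rightarrow>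
   complex ^ (('a ^ 'n option) set) \<Rightarrow> complex ^ (('a ^ 'n option) set)" where
  "char_proj \<psi> v = (\<Sum>g\<in>carrier H_group. cnj (\<psi> g) *s H_act g v)"

definition W_iso ::
  "('a::{field,finite} ^ 'n::finite option ^ 'n option \<Rightarrow> complex) \<Rightarrow> (complex ^ (('a ^ 'n option) set)) set" where
  "W_iso \<psi> = isotypic H_group H_act (free_space Aq) \<psi>"

definition W_rank ::
  "('a::{field,finite} ^ 'n::finite option ^ 'n option \<Rightarrow> complex) \<Rightarrow> nat \<Rightarrow>
   (complex ^ (('a ^ 'n option) set)) set" where
  "W_rank \<psi> k = isotypic H_group H_act (free_space (rank_part Aq k)) \<psi>"

definition theta ::
  "complex ^ (('a::{field,finite} ^ 'n::finite option) set) \<Rightarrow> complex ^ (('a ^ 'n option) set)" where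
  "theta = lin_ext (Bq Fqn) (\<lambda>X. \<Sum>Y | Y \<in> Aq \<and> Aq_equiv Y (hat X). bvec Y)"

definition lambda_map ::
  "('a::{field,finite} ^ 'n::finite option ^ 'n option \<Rightarrow> complex) \<Rightarrow> ('a ^ 'n option) set \<Rightarrow>
   complex ^ (('a ^ 'n option) set) \<Rightarrow> complex ^ (('a ^ 'n option) set)" where
  "lambda_map \<psi> X = lin_ext (Bq X) (\<lambda>Y. char_proj \<psi> (bvec (hat Y)))"

end

theory Submission
  imports Defs "HOL-Number_Theory.Cong" "Jordan_Normal_Form.Spectral_Radius"
begin

no_notation Matrix.vec_index (infixl "$" 100)

text \<open>
  Fix a nontrivial additive character \<open>c\<close> of the field. The translation group is commutative, so
  its irreducible characters have degree one; they are the \<open>\<chi>\<^sub>b(a) = c(b \<cdot> a)\<close> for vectors \<open>b\<close>.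
  Every subspace outside the hyperplane is a translate of some \<open>hat X\<close>, and the projection
  \<open>p(\<chi>\<^sub>b)\<close> maps onto the isotypic component, so the vectors \<open>p(\<chi>\<^sub>b)(hat X)\<close> span it. They are
  pairwise orthogonal, since translation keeps the intersection with the hyperplane, and the
  coordinate of \<open>p(\<chi>\<^sub>b)(hat X)\<close> at \<open>hat X\<close> is a character sum over the stabilizer \<open>X\<close> of \<open>hat X\<close>:
  it is \<open>|X|\<close> if \<open>X\<close> is orthogonal to \<open>b\<close>, and \<open>0\<close> otherwise. Hence the isotypic component of
  \<open>\<chi>\<^sub>b\<close> is a copy, with squared norms \<open>q^n |X|\<close>, of the free space on the subspaces of the
  orthogonal complement of \<open>b\<close>. The up operator is intertwined because the subspaces covering a
  translate of \<open>hat X\<close> are the same translates of the \<open>hat Y\<close> with \<open>Y\<close> covering \<open>X\<close>. The map \<open>\<theta>\<close>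
  is the case \<open>b = 0\<close> rescaled by \<open>1 / |X|\<close>, which accounts for the factor \<open>q\<close> in front of the up
  operator.
\<close>

section \<open>Subspaces over a finite field\<close>

lemma one_less_CARD_field: "1 < CARD('a::{field,finite})"
  using card_mono[of UNIV "{0, 1 :: 'a}"] by simp

lemma subspace_basisE:
  fixes S :: "('k::field ^ 'm::finite) set"
  assumes "vec.subspace S"
  obtains B where "vec.independent B" "vec.span B = S" "card B = vec.dim S"
proof -
  obtain B where B: "B \<subseteq> S" "vec.independent B" "S \<subseteq> vec.span B" "card B = vec.dim S"
    by (rule vec.basis_exists)
  then have "vec.span B = S" using assms by (intro vec.span_subspace)
  with B show ?thesis using that by blast
qed

lemma card_span_independent:
  fixes B :: "('a::{field,finite} ^ 'm::finite) set"
  assumes "vec.independent B"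
  shows "card (vec.span B) = CARD('a) ^ card B"
proof -
  let ?comb = "\<lambda>u. \<Sum>b\<in>B. u b *s b"
  have inj: "inj_on ?comb (B \<rightarrow>\<^sub>E UNIV)"
  proof (rule inj_onI)
    fix u v assume uv: "u \<in> B \<rightarrow>\<^sub>E UNIV" "v \<in> B \<rightarrow>\<^sub>E UNIV" and "?comb u = ?comb v"
    then have "(\<Sum>b\<in>B. (u b - v b) *s b) = 0"
      by (simp add: vec.scale_left_diff_distrib sum_subtractf)
    then have "u b = v b" if "b \<in> B" for b
      using vec.independentD[OF assms, of B "\<lambda>b. u b - v b"] that by simp
    then show "u = v" using uv by (metis PiE_ext)
  qed
  have "?comb u = ?comb (restrict u B)" for u by simp
  then have "?comb ` (B \<rightarrow>\<^sub>E UNIV) = range ?comb"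
    by (auto intro: image_eqI[of _ _ "restrict u B" for u])
  also have "\<dots> = vec.span B" by (rule vec.span_finite[symmetric]) simp
  finally have "card (vec.span B) = card (B \<rightarrow>\<^sub>E (UNIV :: 'a set))"
    by (metis card_image[OF inj])
  then show ?thesis by (simp add: card_PiE)
qed

lemma card_subspace:
  fixes S :: "('a::{field,finite} ^ 'm::finite) set"
  assumes "vec.subspace S"
  shows "card S = CARD('a) ^ vec.dim S"
  using subspace_basisE[OF assms] card_span_independent by metis

lemma dim_eq_iff_card_eq:
  fixes S :: "('a::{field,finite} ^ 'm::finite) set"
  assumes "vec.subspace S"
  shows "vec.dim S = k \<longleftrightarrow> card S = CARD('a) ^ k"
  using card_subspace[OF assms] one_less_CARD_field[where 'a = 'a] by simp

lemma covers_in_Bq_iff_dim: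
  fixes V :: "('a::{field,finite} ^ 'm::finite) set"
  shows "covers_in (Bq V) Z Y \<longleftrightarrow>
    vec.subspace Y \<and> vec.subspace Z \<and> Y \<subset> Z \<and> Z \<subseteq> V \<and> vec.dim Z = Suc (vec.dim Y)"
proof (intro iffI conjI)
  assume covers: "covers_in (Bq V) Z Y"
  then have Y: "vec.subspace Y" and Z: "vec.subspace Z" and "Z \<subseteq> V" and "Y \<subset> Z"
    by (auto simp: covers_in_def Bq_def)
  then obtain x where x: "x \<in> Z" "x \<notin> Y" by blast
  let ?W = "vec.span (insert x Y)"
  have W: "?W \<subseteq> Z" using x Z \<open>Y \<subset> Z\<close> by (intro vec.span_minimal) auto
  then have "?W \<in> Bq V" using \<open>Z \<subseteq> V\<close> by (auto simp: Bq_def)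
  moreover have "Y \<subset> ?W" using x(2) vec.span_superset[of "insert x Y"] by blast
  ultimately have "?W = Z" using covers W by (auto simp: covers_in_def)
  then have "vec.dim Z = vec.dim (insert x Y)" by (metis vec.dim_span)
  then show "vec.dim Z = Suc (vec.dim Y)"
    using x(2) Y by (simp add: vec.dim_insert vec.span_eq_iff[THEN iffD2])
next
  assume subspaces: "vec.subspace Y \<and> vec.subspace Z \<and> Y \<subset> Z \<and> Z \<subseteq> V \<and> vec.dim Z = Suc (vec.dim Y)"
  have "vec.dim S < vec.dim T" if "vec.subspace S" "vec.subspace T" "S \<subset> T"
    for S T :: "('a ^ 'm) set"
    using that vec.dim_psubset[of S T] by (simp add: vec.span_eq_iff[THEN iffD2])
  moreover have "vec.subspace W" if "W \<in> Bq V" for W using that by (simp add: Bq_def)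
  ultimately have "vec.dim Y < vec.dim W \<and> vec.dim W < vec.dim Z"
    if "W \<in> Bq V" "Y \<subset> W" "W \<subset> Z" for W
    using subspaces that by blast
  then have "\<not> (\<exists>W\<in>Bq V. Y \<subset> W \<and> W \<subset> Z)" using subspaces by fastforce
  moreover have "Y \<in> Bq V" "Z \<in> Bq V" using subspaces by (auto simp: Bq_def)
  ultimately show "covers_in (Bq V) Z Y" using subspaces by (simp add: covers_in_def)
qed (auto simp: covers_in_def Bq_def)

section \<open>Characters of finite vector spaces\<close>

lemma CHAR_finite_field_pos: "0 < CHAR('a::{field,finite})"
  by (intro finite_imp_CHAR_pos) simp

lemma prime_CHAR_finite_field: "prime (CHAR('a::{field,finite}))"
  by (intro prime_CHAR_semidom CHAR_finite_field_pos)

lemma ex_of_int_inverse: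
  assumes "(of_int k :: 'a::{field,finite}) \<noteq> 0"
  shows "\<exists>l. of_int l * of_int k = (1 :: 'a)"
proof -
  have "\<not> int CHAR('a) dvd k"
    using assms of_int_eq_iff_cong_CHAR[where 'a = 'a, of k 0] by (simp add: cong_0_iff)
  then have "coprime k (int CHAR('a))"
    using prime_CHAR_finite_field[where 'a = 'a] prime_imp_coprime[of "int CHAR('a)" k]
    by (simp add: coprime_commute)
  then obtain l where "[k * l = 1] (mod int CHAR('a))"
    using cong_solve_coprime_int by blast
  then have "of_int (l * k) = (of_int 1 :: 'a)"
    by (simp only: of_int_eq_iff_cong_CHAR mult.commute)
  then show ?thesis by (intro exI[of _ l]) simp
qed

definition add_subgroup :: "'g::ab_group_add set \<Rightarrow> bool" where
  "add_subgroup S \<longleftrightarrow> 0 \<in> S \<and> (\<forall>x\<in>S. \<forall>y\<in>S. x - y \<in> S)"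

lemma add_subgroup_0: "add_subgroup S \<Longrightarrow> 0 \<in> S"
  by (simp add: add_subgroup_def)

lemma add_subgroup_diff: "add_subgroup S \<Longrightarrow> x \<in> S \<Longrightarrow> y \<in> S \<Longrightarrow> x - y \<in> S"
  by (simp add: add_subgroup_def)

lemma add_subgroup_add: "add_subgroup S \<Longrightarrow> x \<in> S \<Longrightarrow> y \<in> S \<Longrightarrow> x + y \<in> S"
  using add_subgroup_diff[of S x "0 - y"] add_subgroup_diff[of S 0 y]
  by (simp add: add_subgroup_0)

lemma add_subgroup_of_int_mult:
  fixes x :: "'a::ring_1"
  assumes S: "add_subgroup S" and x: "x \<in> S"
  shows "of_int k * x \<in> S"
proof (induction k rule: int_induct[of _ 0])
  case base
  show ?case using S by (simp add: add_subgroup_0)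
next
  case (step1 k)
  then show ?case using add_subgroup_add[OF S x step1(2)] by (simp add: distrib_right add.commute)
next
  case (step2 k)
  then show ?case using add_subgroup_diff[OF S _ x] by (simp add: algebra_simps)
qed

lemma add_subgroup_subspace: "vec.subspace S \<Longrightarrow> add_subgroup S"
  by (simp add: add_subgroup_def vec.subspace_0 vec.subspace_diff)

lemma add_subgroup_adjoin:
  fixes x :: "'a::ring_1"
  assumes S: "add_subgroup S"
  shows "add_subgroup {y. \<exists>k. y - of_int k * x \<in> S}"
  unfolding add_subgroup_def
proof (intro conjI ballI)
  show "0 \<in> {y. \<exists>k. y - of_int k * x \<in> S}"
    using add_subgroup_0[OF S] by (auto intro: exI[of _ 0])
next
  fix y z assume "y \<in> {y. \<exists>k. y - of_int k * x \<in> S}" "z \<in> {y. \<exists>k. y - of_int k * x \<in> S}"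
  then obtain k l where "y - of_int k * x \<in> S" "z - of_int l * x \<in> S" by blast
  then have "(y - of_int k * x) - (z - of_int l * x) \<in> S" by (rule add_subgroup_diff[OF S])
  then have "(y - z) - of_int (k - l) * x \<in> S" by (simp add: algebra_simps)
  then show "y - z \<in> {y. \<exists>k. y - of_int k * x \<in> S}" by blast
qed

text \<open>A subgroup that is maximal among those avoiding \<open>1\<close> works: adjoining to it an \<open>x\<close> that is not
  congruent to any integer would still avoid \<open>1\<close>, because nonzero integers are invertible.\<close>

lemma ex_complement_of_prime_field:
  "\<exists>S :: 'a::{field,finite} set. add_subgroup S \<and>
    (\<forall>k. of_int k \<in> S \<longrightarrow> of_int k = (0 :: 'a)) \<and> (\<forall>x. \<exists>k. x - of_int k \<in> S)"
proof -
  let ?avoiding = "{S. add_subgroup S \<and> (1 :: 'a) \<notin> S}"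
  have "{0} \<in> ?avoiding" by (simp add: add_subgroup_def)
  then obtain S :: "'a set" where S: "add_subgroup S" and "1 \<notin> S"
    and maximal: "\<And>T. add_subgroup T \<Longrightarrow> 1 \<notin> T \<Longrightarrow> S \<subseteq> T \<Longrightarrow> T = S"
    using finite_has_maximal2[of ?avoiding "{0}"] by auto
  have avoid: "of_int k = (0 :: 'a)" if "of_int k \<in> S" for k
    using ex_of_int_inverse[where 'a = 'a, of k] add_subgroup_of_int_mult[OF S that] \<open>1 \<notin> S\<close>
    by metis
  have "\<exists>k. x - of_int k \<in> S" for x
  proof (rule ccontr)
    assume incongruent: "\<nexists>k. x - of_int k \<in> S"
    let ?T = "{y. \<exists>k. y - of_int k * x \<in> S}"
    have "1 \<notin> ?T"
    proof
      assume "1 \<in> ?T"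
      then obtain k where combination: "1 - of_int k * x \<in> S" by blast
      then have "of_int k \<noteq> (0 :: 'a)" using \<open>1 \<notin> S\<close> by auto
      from ex_of_int_inverse[OF this] obtain l where inverse: "of_int l * of_int k = (1 :: 'a)" ..
      have "of_int (- l) * (1 - of_int k * x) \<in> S"
        using S combination by (rule add_subgroup_of_int_mult)
      moreover have "of_int (- l) * (1 - of_int k * x) = x - of_int l"
        using inverse by (simp add: algebra_simps)
      ultimately show False using incongruent by metis
    qed
    moreover have "S \<subseteq> ?T" by (auto intro: exI[of _ 0])
    ultimately have "?T = S" using maximal add_subgroup_adjoin[OF S] by blast
    moreover have "x \<in> ?T" using add_subgroup_0[OF S] by (auto intro: exI[of _ 1])
    ultimately have "x - of_int 0 \<in> S" by simp
    then show False using incongruent by blast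
  qed
  then show ?thesis using S avoid by blast
qed

lemma ex_nontrivial_root_of_unity:
  assumes "1 < n"
  shows "\<exists>\<omega>::complex. \<omega> ^ n = 1 \<and> \<omega> \<noteq> 1"
proof (rule ccontr)
  assume "\<not> ?thesis"
  then have "{z::complex. z ^ n = 1} \<subseteq> {1}" by blast
  then have "card {z::complex. z ^ n = 1} \<le> 1" using card_mono[of "{1::complex}"] by simp
  then show False using card_roots_unity_eq[of n] assms by simp
qed

lemma power_int_eq_if_of_int_eq:
  fixes \<omega> :: "'b::field"
  assumes "\<omega> \<noteq> 0" "\<omega> ^ CHAR('a::ring_1) = 1" and "of_int k = (of_int l :: 'a)"
  shows "\<omega> powi k = \<omega> powi l"
proof -
  have "int CHAR('a) dvd k - l"
    using assms(3) by (simp add: of_int_eq_iff_cong_CHAR cong_iff_dvd_diff)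
  then obtain m where "k = l + int CHAR('a) * m" by (metis dvdE diff_add_cancel add.commute)
  then show ?thesis using assms(1,2) by (simp add: power_int_add power_int_mult)
qed

lemma ex_nontrivial_additive_character:
  "\<exists>c :: 'a::{field,finite} \<Rightarrow> complex. (\<forall>x y. c (x + y) = c x * c y) \<and> c 0 = 1 \<and> c 1 \<noteq> 1"
proof -
  obtain S :: "'a set" where S: "add_subgroup S"
    and avoid: "\<And>k. of_int k \<in> S \<Longrightarrow> of_int k = (0 :: 'a)" and ex: "\<And>x. \<exists>k. x - of_int k \<in> S"
    using ex_complement_of_prime_field[where 'a = 'a] by (elim exE conjE) simp
  obtain \<omega> :: complex where \<omega>: "\<omega> ^ CHAR('a) = 1" "\<omega> \<noteq> 1"
    using ex_nontrivial_root_of_unity prime_gt_1_nat prime_CHAR_finite_field by blast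
  have "\<omega> \<noteq> 0"
    using \<omega>(1) CHAR_finite_field_pos[where 'a = 'a] by (auto simp: power_0_left)
  define c where "c x = \<omega> powi (SOME k. x - of_int k \<in> S)" for x :: 'a
  have unique: "of_int k = (of_int l :: 'a)" if "x - of_int k \<in> S" "x - of_int l \<in> S" for x k l
    using avoid[of "l - k"] add_subgroup_diff[OF S that] by simp
  have c_eq: "c x = \<omega> powi k" if "x - of_int k \<in> S" for x k
    unfolding c_def using \<open>\<omega> \<noteq> 0\<close> \<omega>(1) unique[OF someI_ex[OF ex] that]
    by (rule power_int_eq_if_of_int_eq)
  have "c (x + y) = c x * c y" for x y
  proof -
    obtain k l where kl: "x - of_int k \<in> S" "y - of_int l \<in> S" using ex by metis
    have "(x + y) - of_int (k + l) \<in> S"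
      using add_subgroup_add[OF S kl] by (simp add: algebra_simps)
    then have "c (x + y) = \<omega> powi (k + l)" by (rule c_eq)
    then show ?thesis using \<open>\<omega> \<noteq> 0\<close> kl by (simp add: c_eq power_int_add)
  qed
  moreover have "c 0 = 1" using c_eq[of 0 0] add_subgroup_0[OF S] by simp
  moreover have "c 1 = \<omega>" using c_eq[of 1 1] add_subgroup_0[OF S] by simp
  ultimately show ?thesis using \<omega>(2) by blast
qed

definition add_char :: "'a::{field,finite} \<Rightarrow> complex" where
  "add_char = (SOME c. (\<forall>x y. c (x + y) = c x * c y) \<and> c 0 = 1 \<and> c 1 \<noteq> 1)"

lemma add_char_add: "add_char (x + y) = add_char x * add_char y"
  and add_char_0 [simp]: "add_char (0 :: 'a::{field,finite}) = 1"
  and add_char_1: "add_char (1 :: 'a) \<noteq> 1"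
  using someI_ex[OF ex_nontrivial_additive_character, folded add_char_def] by blast+

lemma add_char_mult_minus [simp]: "add_char x * add_char (- x) = 1"
  by (simp flip: add_char_add)

lemma add_char_nonzero [simp]: "add_char x \<noteq> 0"
  by (metis add_char_mult_minus mult_zero_left zero_neq_one)

lemma norm_add_char [simp]: "cmod (add_char (x :: 'a::{field,finite})) = 1"
proof -
  have "add_char (of_nat k * x) = add_char x ^ k" for k
    by (induction k) (simp_all add: distrib_right add_char_add)
  from this[of "CHAR('a)"] have "add_char x ^ CHAR('a) = 1" by simp
  then show ?thesis
    using power_eq_1_iff[of "add_char x" "CHAR('a)"] CHAR_finite_field_pos[where 'a = 'a] by simp
qed

lemma cnj_add_char: "cnj (add_char x) = add_char (- x)"
proof -
  have "add_char x * cnj (add_char x) = 1" by (simp flip: complex_norm_square)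
  then show ?thesis by (metis add_char_mult_minus add_char_nonzero mult_left_cancel)
qed

lemma scalar_product_commute:
  "scalar_product b x = scalar_product x b" for b :: "'a::comm_semiring_1 ^ 'n::finite"
  by (simp add: scalar_product_def mult.commute)

lemma scalar_product_simps [simp]:
  fixes b c x y :: "'a::comm_ring_1 ^ 'n::finite"
  shows "scalar_product b (x + y) = scalar_product b x + scalar_product b y"
    and "scalar_product b (x - y) = scalar_product b x - scalar_product b y"
    and "scalar_product b (- x) = - scalar_product b x"
    and "scalar_product b 0 = 0" and "scalar_product 0 x = 0"
    and "scalar_product b (k *s x) = k * scalar_product b x"
    and "scalar_product (b + c) x = scalar_product b x + scalar_product c x"
    and "scalar_product (b - c) x = scalar_product b x - scalar_product c x"
    and "scalar_product (k *s b) x = k * scalar_product b x"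
  by (simp_all add: scalar_product_def algebra_simps sum.distrib sum_subtractf sum_negf
      sum_distrib_left)

lemma ex_scalar_product_eq:
  fixes b :: "'a::field ^ 'n::finite"
  assumes "b \<noteq> 0"
  shows "\<exists>x. scalar_product b x = t"
proof -
  obtain i where "b $ i \<noteq> 0" using assms by (auto simp: Finite_Cartesian_Product.vec_eq_iff)
  then have "scalar_product b (axis i (t / b $ i)) = t"
    by (simp add: scalar_product_def axis_def if_distrib cong: if_cong)
  then show ?thesis ..
qed

abbreviation vchar :: "'a::{field,finite} ^ 'n::finite \<Rightarrow> 'a ^ 'n \<Rightarrow> complex" where
  "vchar b x \<equiv> add_char (scalar_product b x)"

definition annihilator :: "('a::field ^ 'n::finite) set \<Rightarrow> ('a ^ 'n) set" where
  "annihilator S = {b. \<forall>x\<in>S. scalar_product b x = 0}"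

lemma subspace_annihilator: "vec.subspace (annihilator S)"
  by (rule vec.subspaceI) (auto simp: annihilator_def)

lemma annihilator_span: "annihilator (vec.span S) = annihilator S"
proof
  show "annihilator (vec.span S) \<subseteq> annihilator S"
    by (auto simp: annihilator_def vec.span_base)
  show "annihilator S \<subseteq> annihilator (vec.span S)"
  proof
    fix b assume "b \<in> annihilator S"
    then have "S \<subseteq> {x. scalar_product b x = 0}" by (auto simp: annihilator_def)
    moreover have "vec.subspace {x. scalar_product b x = 0}" by (rule vec.subspaceI) auto
    ultimately have "vec.span S \<subseteq> {x. scalar_product b x = 0}" by (rule vec.span_minimal)
    then show "b \<in> annihilator (vec.span S)" by (auto simp: annihilator_def)
  qed
qed

lemma annihilator_UNIV: "annihilator UNIV = {0}"
proof -
  have "b = 0" if "b \<in> annihilator UNIV" for b :: "'a ^ 'n"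
    using that ex_scalar_product_eq[of b 1] by (auto simp: annihilator_def)
  then show ?thesis by (auto simp: annihilator_def)
qed

lemma sum_character_subgroup:
  fixes h :: "'g::ab_group_add \<Rightarrow> 'r::idom"
  assumes hom: "\<And>x y. h (x + y) = h x * h y"
    and S: "add_subgroup S" and "a \<in> S" "h a \<noteq> 1"
  shows "(\<Sum>x\<in>S. h x) = 0"
proof -
  have "(\<Sum>x\<in>S. h x) = (\<Sum>x\<in>S. h (a + x))"
    by (rule sum.reindex_bij_witness[of _ "\<lambda>x. a + x" "\<lambda>x. x - a"])
      (use S \<open>a \<in> S\<close> in \<open>auto simp: add_subgroup_add add_subgroup_diff\<close>)
  also have "\<dots> = h a * (\<Sum>x\<in>S. h x)" by (simp add: hom sum_distrib_left)
  finally show ?thesis using \<open>h a \<noteq> 1\<close> by (metis mult_cancel_right1)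
qed

lemma annihilator_iff_vchar_trivial:
  assumes "vec.subspace S"
  shows "b \<in> annihilator S \<longleftrightarrow> (\<forall>x\<in>S. vchar b x = 1)"
proof
  assume trivial: "\<forall>x\<in>S. vchar b x = 1"
  have "scalar_product b x = 0" if "x \<in> S" for x
  proof (rule ccontr)
    assume "scalar_product b x \<noteq> 0"
    then have "vchar b ((1 / scalar_product b x) *s x) \<noteq> 1" using add_char_1 by simp
    then show False using trivial vec.subspace_scale[OF assms that] by blast
  qed
  then show "b \<in> annihilator S" by (simp add: annihilator_def)
qed (simp add: annihilator_def)

lemma sum_vchar_subspace:
  assumes "vec.subspace S"
  shows "(\<Sum>x\<in>S. vchar b x) = (if b \<in> annihilator S then of_nat (card S) else 0)"
proof (cases "b \<in> annihilator S")
  case True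
  then show ?thesis by (simp add: annihilator_def)
next
  case False
  then obtain a where "a \<in> S" "vchar b a \<noteq> 1" using annihilator_iff_vchar_trivial[OF assms] by blast
  then have "(\<Sum>x\<in>S. vchar b x) = 0"
    using add_subgroup_subspace[OF assms]
    by (intro sum_character_subgroup[where a = a]) (simp_all add: add_char_add)
  then show ?thesis using False by simp
qed

lemma sum_vchar_UNIV:
  "(\<Sum>x\<in>UNIV. vchar b x) = (if b = 0 then of_nat (CARD('a) ^ CARD('n)) else 0)"
  for b :: "'a::{field,finite} ^ 'n::finite"
  unfolding sum_vchar_subspace[OF vec.subspace_UNIV] annihilator_UNIV by simp

lemma card_annihilator_mult_card:
  fixes S :: "('a::{field,finite} ^ 'n::finite) set"
  assumes "vec.subspace S"
  shows "card (annihilator S) * card S = CARD('a) ^ CARD('n)"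
proof -
  have "of_nat (card (annihilator S) * card S) =
      (\<Sum>b\<in>UNIV. if b \<in> annihilator S then of_nat (card S) else 0 :: complex)"
    by (simp add: sum.If_cases)
  also have "\<dots> = (\<Sum>b\<in>UNIV. \<Sum>x\<in>S. vchar b x)" by (simp only: sum_vchar_subspace[OF assms])
  also have "\<dots> = (\<Sum>x\<in>S. \<Sum>b\<in>UNIV. vchar x b)"
    by (subst sum.swap) (simp add: scalar_product_commute)
  also have "\<dots> = of_nat (CARD('a) ^ CARD('n))"
    using vec.subspace_0[OF assms] by (simp add: sum_vchar_UNIV)
  finally show ?thesis by (simp only: of_nat_eq_iff)
qed

text \<open>The sum over all \<open>b\<close> of the Fourier coefficients of \<open>h\<close> is \<open>q^n h(0)\<close>, so not all of them
  vanish.\<close>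

lemma character_eq_vchar:
  fixes h :: "'a::{field,finite} ^ 'n::finite \<Rightarrow> complex"
  assumes hom: "\<And>x y. h (x + y) = h x * h y" and "h 0 = 1"
  shows "\<exists>b. h = vchar b"
proof (rule ccontr)
  assume other: "\<nexists>b. h = vchar b"
  have Fourier_0: "(\<Sum>x\<in>UNIV. h x * vchar b (- x)) = 0" for b
  proof -
    obtain a where "h a \<noteq> vchar b a" using other by blast
    moreover have "h a = h a * vchar b (- a) * vchar b a"
      by (simp add: mult.commute[of _ "vchar b a"])
    ultimately have nontrivial: "h a * vchar b (- a) \<noteq> 1" by (metis mult_1)
    have "h (x + y) * vchar b (- (x + y)) = (h x * vchar b (- x)) * (h y * vchar b (- y))" for x y
      by (simp only: minus_add_distrib scalar_product_simps add_char_add hom mult_ac)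
    then show ?thesis
      using add_subgroup_subspace[OF vec.subspace_UNIV] UNIV_I nontrivial
      by (rule sum_character_subgroup)
  qed
  have "0 = (\<Sum>b\<in>UNIV. \<Sum>x\<in>UNIV. h x * vchar b (- x))" by (simp only: Fourier_0) simp
  also have "\<dots> = (\<Sum>x\<in>UNIV. h x * (\<Sum>b\<in>UNIV. vchar (- x) b))"
    by (subst sum.swap) (simp only: sum_distrib_left scalar_product_commute[of _ "- x" for x])
  also have "\<dots> = of_nat (CARD('a) ^ CARD('n))"
    by (simp add: sum_vchar_UNIV if_distrib[of "(*) _"] \<open>h 0 = 1\<close> cong: if_cong)
  finally show False by simp
qed

lemma vchar_inj:
  fixes b c :: "'a::{field,finite} ^ 'n::finite"
  assumes "vchar b = vchar c"
  shows "b = c"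
proof (rule ccontr)
  assume "b \<noteq> c"
  then obtain x where "scalar_product (b - c) x = 1"
    using ex_scalar_product_eq[of "b - c" 1] by auto
  then have "scalar_product b x = scalar_product c x + 1"
    by (simp add: diff_eq_eq add.commute)
  then have "vchar b x = vchar c x * add_char (1 :: 'a)" by (simp add: add_char_add)
  then show False using fun_cong[OF assms, of x] add_char_1[where 'a = 'a] by simp
qed

section \<open>Representations of commutative monoids\<close>

lemma subspace_module_vecI:
  fixes W :: "'k::field Matrix.vec set"
  assumes "W \<subseteq> carrier_vec d" "0\<^sub>v d \<in> W"
    and "\<And>v w. v \<in> W \<Longrightarrow> w \<in> W \<Longrightarrow> v + w \<in> W" "\<And>c v. v \<in> W \<Longrightarrow> c \<cdot>\<^sub>v v \<in> W"
  shows "VectorSpace.subspace class_ring W (module_vec TYPE('k) d)"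
proof -
  have "submodule class_ring W (module_vec TYPE('k) d)"
    unfolding submodule_def using assms vec_module[of d] by (simp add: module_vec_simps)
  then show ?thesis by (simp add: VectorSpace.subspace_def vec_vs)
qed

lemma subspace_line_vec:
  fixes v :: "'k::field Matrix.vec"
  assumes "v \<in> carrier_vec d"
  shows "VectorSpace.subspace class_ring (range (\<lambda>c. c \<cdot>\<^sub>v v)) (module_vec TYPE('k) d)"
proof (rule subspace_module_vecI)
  have "0 \<cdot>\<^sub>v v = 0\<^sub>v d" using assms by auto
  then show "0\<^sub>v d \<in> range (\<lambda>c. c \<cdot>\<^sub>v v)" by (metis rangeI)
  show "u + w \<in> range (\<lambda>c. c \<cdot>\<^sub>v v)" if "u \<in> range (\<lambda>c. c \<cdot>\<^sub>v v)" "w \<in> range (\<lambda>c. c \<cdot>\<^sub>v v)" for u w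
    using that by (auto simp flip: add_smult_distrib_vec)
  show "c \<cdot>\<^sub>v w \<in> range (\<lambda>c. c \<cdot>\<^sub>v v)" if "w \<in> range (\<lambda>c. c \<cdot>\<^sub>v v)" for c w
    using that by (auto simp: smult_smult_assoc)
qed (use assms in auto)

lemma subspace_eigenspace:
  fixes A :: "'k::field Matrix.mat"
  assumes A: "A \<in> carrier_mat d d"
  shows "VectorSpace.subspace class_ring {v \<in> carrier_vec d. A *\<^sub>v v = c \<cdot>\<^sub>v v}
    (module_vec TYPE('k) d)"
proof (rule subspace_module_vecI)
  show "0\<^sub>v d \<in> {v \<in> carrier_vec d. A *\<^sub>v v = c \<cdot>\<^sub>v v}" using A by auto
  fix k v w assume v: "v \<in> {v \<in> carrier_vec d. A *\<^sub>v v = c \<cdot>\<^sub>v v}"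
  then show "k \<cdot>\<^sub>v v \<in> {v \<in> carrier_vec d. A *\<^sub>v v = c \<cdot>\<^sub>v v}"
    using mult_mat_vec[OF A, of v k] by (simp add: smult_smult_assoc mult.commute)
  assume "w \<in> {v \<in> carrier_vec d. A *\<^sub>v v = c \<cdot>\<^sub>v v}"
  then show "v + w \<in> {v \<in> carrier_vec d. A *\<^sub>v v = c \<cdot>\<^sub>v v}"
    using v by (simp add: mult_add_distrib_mat_vec[OF A] smult_add_distrib_vec[of v d w])
qed auto

lemma irreducible_matrix_rep_scalar:
  assumes irr: "irreducible_matrix_rep G d \<rho>" and G: "comm_monoid G" and g: "g \<in> carrier G"
  shows "\<exists>c. \<forall>v\<in>carrier_vec d. \<rho> g *\<^sub>v v = c \<cdot>\<^sub>v v"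
proof -
  have \<rho>: "\<rho> h \<in> carrier_mat d d" if "h \<in> carrier G" for h
    using irr that by (simp add: irreducible_matrix_rep_def matrix_rep_def)
  have mult: "\<rho> (h \<otimes>\<^bsub>G\<^esub> k) = \<rho> h * \<rho> k" if "h \<in> carrier G" "k \<in> carrier G" for h k
    using irr that by (simp add: irreducible_matrix_rep_def matrix_rep_def)
  have commute: "\<rho> g * \<rho> h = \<rho> h * \<rho> g" if "h \<in> carrier G" for h
    using mult[OF g that] mult[OF that g] comm_monoid.m_comm[OF G g that] by simp
  have "d > 0" using irr by (simp add: irreducible_matrix_rep_def)
  with \<rho>[OF g] obtain c v where "eigenvector (\<rho> g) v c"
    using spectrum_non_empty by (metis all_not_in_conv eigenvalue_def mem_Collect_eq spectrum_def)
  then have v: "v \<in> carrier_vec d" "v \<noteq> 0\<^sub>v d" "\<rho> g *\<^sub>v v = c \<cdot>\<^sub>v v"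
    using \<rho>[OF g] by (auto simp: eigenvector_def)
  let ?E = "{v \<in> carrier_vec d. \<rho> g *\<^sub>v v = c \<cdot>\<^sub>v v}"
  have "\<rho> h *\<^sub>v w \<in> ?E" if h: "h \<in> carrier G" and w: "w \<in> ?E" for h w
  proof -
    have "\<rho> g *\<^sub>v (\<rho> h *\<^sub>v w) = (\<rho> g * \<rho> h) *\<^sub>v w"
      using w by (simp add: assoc_mult_mat_vec[OF \<rho>[OF g] \<rho>[OF h]])
    also have "\<dots> = \<rho> h *\<^sub>v (\<rho> g *\<^sub>v w)"
      unfolding commute[OF h] using w by (simp add: assoc_mult_mat_vec[OF \<rho>[OF h] \<rho>[OF g]])
    finally show ?thesis using w \<rho>[OF h] by (simp add: mult_mat_vec[OF \<rho>[OF h]])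
  qed
  then have "?E = {0\<^sub>v d} \<or> ?E = carrier_vec d"
    using irr subspace_eigenspace[OF \<rho>[OF g]] by (simp add: irreducible_matrix_rep_def)
  then have "?E = carrier_vec d" using v by blast
  then show ?thesis by blast
qed

lemma irreducible_matrix_rep_comm_monoid:
  assumes irr: "irreducible_matrix_rep G d \<rho>" and G: "comm_monoid G"
  shows "d = 1"
proof (rule ccontr)
  assume "d \<noteq> 1"
  then have "1 < d" using irr by (simp add: irreducible_matrix_rep_def)
  let ?e = "unit_vec d 0 :: complex Matrix.vec"
  let ?L = "range (\<lambda>c. c \<cdot>\<^sub>v ?e)"
  have "\<rho> g *\<^sub>v v \<in> ?L" if g: "g \<in> carrier G" and v: "v \<in> ?L" for g v
  proof -
    obtain c where "\<forall>v\<in>carrier_vec d. \<rho> g *\<^sub>v v = c \<cdot>\<^sub>v v"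
      using irreducible_matrix_rep_scalar[OF irr G g] by blast
    then show ?thesis using v by (auto simp: smult_smult_assoc)
  qed
  then have "?L = {0\<^sub>v d} \<or> ?L = carrier_vec d"
    using irr subspace_line_vec[of ?e d] by (simp add: irreducible_matrix_rep_def)
  moreover have "1 \<cdot>\<^sub>v ?e \<in> ?L" by (rule rangeI)
  moreover have "1 \<cdot>\<^sub>v ?e \<noteq> 0\<^sub>v d"
  proof
    assume "1 \<cdot>\<^sub>v ?e = 0\<^sub>v d"
    from arg_cong[OF this, of "\<lambda>v. vec_index v 0"] show False using \<open>1 < d\<close> by simp
  qed
  ultimately have "?L = carrier_vec d" by blast
  then have "unit_vec d 1 \<in> ?L" by simp
  then obtain c where "unit_vec d 1 = c \<cdot>\<^sub>v ?e" by blast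
  from arg_cong[OF this, of "\<lambda>v. vec_index v 1"] show False using \<open>1 < d\<close> by simp
qed

lemma irreducible_matrix_rep_1:
  fixes \<phi> :: "'g \<Rightarrow> complex"
  assumes one: "\<phi> \<one>\<^bsub>G\<^esub> = 1"
    and mult: "\<And>g h. g \<in> carrier G \<Longrightarrow> h \<in> carrier G \<Longrightarrow> \<phi> (g \<otimes>\<^bsub>G\<^esub> h) = \<phi> g * \<phi> h"
  shows "irreducible_matrix_rep G 1 (\<lambda>g. Matrix.mat 1 1 (\<lambda>_. \<phi> g))"
  unfolding irreducible_matrix_rep_def matrix_rep_def
proof (intro conjI allI impI ballI)
  show "Matrix.mat 1 1 (\<lambda>_. \<phi> \<one>\<^bsub>G\<^esub>) = 1\<^sub>m 1" by (rule eq_matI) (auto simp: one)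
  show "Matrix.mat 1 1 (\<lambda>_. \<phi> (g \<otimes>\<^bsub>G\<^esub> h)) =
      Matrix.mat 1 1 (\<lambda>_. \<phi> g) * Matrix.mat 1 1 (\<lambda>_. \<phi> h)"
    if "g \<in> carrier G" "h \<in> carrier G" for g h
    by (rule eq_matI) (auto simp: mult that scalar_prod_def)
next
  fix W :: "complex Matrix.vec set"
  assume "VectorSpace.subspace class_ring W (module_vec TYPE(complex) 1) \<and>
    (\<forall>g\<in>carrier G. \<forall>w\<in>W. Matrix.mat 1 1 (\<lambda>_. \<phi> g) *\<^sub>v w \<in> W)"
  then have W: "W \<subseteq> carrier_vec 1" "0\<^sub>v 1 \<in> W" "\<And>c w. w \<in> W \<Longrightarrow> c \<cdot>\<^sub>v w \<in> W"
    by (auto simp: VectorSpace.subspace_def submodule_def module_vec_simps)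
  show "W = {0\<^sub>v 1} \<or> W = carrier_vec 1"
  proof (cases "W \<subseteq> {0\<^sub>v 1}")
    case False
    then obtain w where w: "w \<in> W" "w \<noteq> 0\<^sub>v 1" by blast
    then have dim: "dim_vec w = 1" using W(1) by auto
    have "vec_index w 0 \<noteq> 0"
    proof
      assume "vec_index w 0 = 0"
      then have "w = 0\<^sub>v 1" using dim by (intro eq_vecI) auto
      then show False using w(2) by contradiction
    qed
    then have "u = (vec_index u 0 / vec_index w 0) \<cdot>\<^sub>v w" if "u \<in> carrier_vec 1" for u
      using that dim by (intro eq_vecI) auto
    then have "u \<in> W" if "u \<in> carrier_vec 1" for u using that W(3)[OF w(1)] by metis
    then show ?thesis using W(1) by blast
  qed (use W(2) in blast)
qed auto

definition linear_chars :: "('g, 'r) monoid_scheme \<Rightarrow> ('g \<Rightarrow> complex) set" where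
  "linear_chars G = {\<phi> \<in> extensional (carrier G). \<phi> \<one>\<^bsub>G\<^esub> = 1 \<and>
    (\<forall>g\<in>carrier G. \<forall>h\<in>carrier G. \<phi> (g \<otimes>\<^bsub>G\<^esub> h) = \<phi> g * \<phi> h)}"

lemma irr_chars_comm_monoid:
  assumes G: "comm_monoid G"
  shows "irr_chars G = linear_chars G"
proof (intro subset_antisym subsetI)
  fix \<psi> assume "\<psi> \<in> irr_chars G"
  then obtain d \<rho> where \<psi>: "\<psi> = (\<lambda>g\<in>carrier G. \<Sum>i<d. \<rho> g $$ (i, i))"
    and irr: "irreducible_matrix_rep G d \<rho>"
    unfolding irr_chars_def by blast
  have "d = 1" using irr G by (rule irreducible_matrix_rep_comm_monoid)
  then have \<psi>_eq: "\<psi> = (\<lambda>g\<in>carrier G. \<rho> g $$ (0, 0))" by (simp add: \<psi>)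
  have one: "\<rho> \<one>\<^bsub>G\<^esub> = 1\<^sub>m 1" and dims: "\<And>g. g \<in> carrier G \<Longrightarrow> \<rho> g \<in> carrier_mat 1 1"
    and mult: "\<And>g h. g \<in> carrier G \<Longrightarrow> h \<in> carrier G \<Longrightarrow> \<rho> (g \<otimes>\<^bsub>G\<^esub> h) = \<rho> g * \<rho> h"
    using irr \<open>d = 1\<close> by (simp_all add: irreducible_matrix_rep_def matrix_rep_def)
  have "\<rho> (g \<otimes>\<^bsub>G\<^esub> h) $$ (0, 0) = \<rho> g $$ (0, 0) * \<rho> h $$ (0, 0)"
    if "g \<in> carrier G" "h \<in> carrier G" for g h
    using dims[OF that(1)] dims[OF that(2)] by (simp add: mult[OF that] scalar_prod_def)
  then show "\<psi> \<in> linear_chars G"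
    using comm_monoid.axioms(1)[OF G]
    by (simp add: linear_chars_def \<psi>_eq one monoid.one_closed monoid.m_closed)
next
  fix \<psi> assume \<psi>: "\<psi> \<in> linear_chars G"
  then have "irreducible_matrix_rep G 1 (\<lambda>g. Matrix.mat 1 1 (\<lambda>_. \<psi> g))"
    by (intro irreducible_matrix_rep_1) (simp_all add: linear_chars_def)
  moreover have "\<psi> = (\<lambda>g\<in>carrier G. \<Sum>i<1. Matrix.mat 1 1 (\<lambda>_. \<psi> g) $$ (i, i))"
    using \<psi> by (simp add: linear_chars_def extensional_restrict)
  ultimately show "\<psi> \<in> irr_chars G"
    unfolding irr_chars_def
    by (intro CollectI exI[of _ 1] exI[of _ "\<lambda>g. Matrix.mat 1 1 (\<lambda>_. \<psi> g)"] conjI)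
qed

lemma trace_on_basis:
  assumes "vec.subspace S"
  obtains B where "vec.independent B" "vec.span B = S"
    "\<And>f. trace_on S f = (\<Sum>b\<in>B. vec.representation B (f b) b)"
proof -
  have "\<exists>B. vec.independent B \<and> vec.span B = S" using subspace_basisE[OF assms] by blast
  from someI_ex[OF this] show ?thesis
    by (intro that[of "SOME B. vec.independent B \<and> vec.span B = S"])
      (simp_all add: trace_on_def Let_def)
qed

lemma trace_on_identity:
  assumes S: "vec.subspace S" and id: "\<And>v. v \<in> S \<Longrightarrow> f v = v"
  shows "trace_on S f = of_nat (vec.dim S)"
proof -
  obtain B where B: "vec.independent B" "vec.span B = S"
    and trace: "trace_on S f = (\<Sum>b\<in>B. vec.representation B (f b) b)"
    using S by (rule trace_on_basis) blast
  have "vec.representation B (f b) b = 1" if "b \<in> B" for b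
    using that B vec.span_base[OF that] by (simp add: id vec.representation_basis)
  moreover have "vec.dim S = card B" using B by (metis vec.dim_eq_card_independent vec.dim_span)
  ultimately show ?thesis by (simp add: trace)
qed

lemma trace_on_line:
  assumes "w \<noteq> 0" and scalar: "\<And>u. u \<in> vec.span {w} \<Longrightarrow> f u = c *s u"
  shows "trace_on (vec.span {w}) f = c"
proof -
  obtain B where B: "vec.independent B" "vec.span B = vec.span {w}"
    and trace: "trace_on (vec.span {w}) f = (\<Sum>b\<in>B. vec.representation B (f b) b)"
    by (rule trace_on_basis[OF vec.subspace_span]) blast
  have "card B = vec.dim {w}" using B by (metis vec.dim_eq_card_independent vec.dim_span)
  then obtain u where u: "B = {u}" using \<open>w \<noteq> 0\<close> by (auto simp: card_1_singleton_iff)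
  then have "f u = c *s u" using scalar B(2) vec.span_base by blast
  moreover have "vec.representation {u} (c *s u) u = c"
    using B(1) u by (simp add: vec.representation_scale vec.representation_basis vec.span_base)
  ultimately show ?thesis by (simp add: trace u)
qed

definition weight_space ::
  "('g, 'r) monoid_scheme \<Rightarrow> ('g \<Rightarrow> complex ^ 'b::finite \<Rightarrow> complex ^ 'b) \<Rightarrow>
   (complex ^ 'b) set \<Rightarrow> ('g \<Rightarrow> complex) \<Rightarrow> (complex ^ 'b) set" where
  "weight_space G act M \<psi> = {v \<in> M. \<forall>g\<in>carrier G. act g v = \<psi> g *s v}"

lemma subspace_weight_space:
  assumes "vec.subspace M" "\<And>g. g \<in> carrier G \<Longrightarrow> Vector_Spaces.linear (*s) (*s) (act g)"
  shows "vec.subspace (weight_space G act M \<psi>)"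
  by (rule vec.subspaceI)
    (use assms in \<open>auto simp: weight_space_def vec.subspace_0 vec.subspace_add vec.subspace_scale
      vec.linear_0 vec.linear_add vec.linear_scale vec.scale_right_distrib mult.commute\<close>)

lemma subspace_of_line:
  assumes T: "vec.subspace T" "T \<subseteq> vec.span {v}" "T \<noteq> {0}"
  shows "T = vec.span {v}"
proof -
  obtain x where "x \<in> T" "x \<noteq> 0" using T vec.subspace_0 by blast
  then obtain c where "c *s v \<in> T" "c \<noteq> 0" using T(2) by (auto simp: vec.span_singleton)
  have "v = inverse c *s (c *s v)" using \<open>c \<noteq> 0\<close> by simp
  also have "\<dots> \<in> T" using \<open>c *s v \<in> T\<close> by (rule vec.subspace_scale[OF T(1)])
  finally have "v \<in> T" .
  then show ?thesis using T by (simp add: vec.span_minimal subset_antisym)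
qed

lemma weight_line_irreducible_submodule:
  assumes "v \<noteq> 0" and act: "\<And>g u. g \<in> carrier G \<Longrightarrow> u \<in> vec.span {v} \<Longrightarrow> act g u = \<psi> g *s u"
  shows "irreducible_submodule G act (vec.span {v})"
proof -
  have "vec.span {v} \<noteq> {0}" using \<open>v \<noteq> 0\<close> vec.span_base[of v "{v}"] by auto
  moreover have "act g ` vec.span {v} \<subseteq> vec.span {v}" if "g \<in> carrier G" for g
    using act[OF that] by (auto intro: vec.span_scale)
  ultimately show ?thesis
    unfolding irreducible_submodule_def using subspace_of_line by auto
qed

text \<open>The trace of the identity is the dimension, so a submodule with a character of degree one is a
  line.\<close>

lemma irreducible_submodule_degree_one:
  assumes irr: "irreducible_submodule G act S"
    and trace: "\<And>g. g \<in> carrier G \<Longrightarrow> trace_on S (act g) = \<psi> g"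
    and linear: "\<And>g. g \<in> carrier G \<Longrightarrow> Vector_Spaces.linear (*s) (*s) (act g)"
    and one: "\<one>\<^bsub>G\<^esub> \<in> carrier G" "\<psi> \<one>\<^bsub>G\<^esub> = 1" "\<And>v. v \<in> S \<Longrightarrow> act \<one>\<^bsub>G\<^esub> v = v"
    and g: "g \<in> carrier G" and "v \<in> S"
  shows "act g v = \<psi> g *s v"
proof -
  have S: "vec.subspace S" and stable: "\<And>u. u \<in> S \<Longrightarrow> act g u \<in> S"
    using irr g by (simp_all add: irreducible_submodule_def image_subset_iff)
  have "of_nat (vec.dim S) = trace_on S (act \<one>\<^bsub>G\<^esub>)"
    using one(3) by (intro trace_on_identity[symmetric] S)
  then have "vec.dim S = 1" using trace one by simp
  then obtain w where "w \<noteq> 0" and S_eq: "S = vec.span {w}"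
    using subspace_basisE[OF S] by (metis card_1_singletonE vec.dependent_single)
  obtain c where "act g w = c *s w"
    using stable[of w] vec.span_base[of w "{w}"] by (auto simp: S_eq vec.span_singleton)
  then have scalar: "act g u = c *s u" if "u \<in> S" for u
    using that
    by (auto simp: S_eq vec.span_singleton vec.linear_scale[OF linear[OF g]] mult.commute)
  then have "trace_on S (act g) = c"
    unfolding S_eq using \<open>w \<noteq> 0\<close> by (intro trace_on_line)
  then show ?thesis using scalar[OF \<open>v \<in> S\<close>] trace[OF g] by simp
qed

lemma isotypic_eq_weight_space:
  assumes M: "vec.subspace M"
    and linear: "\<And>g. g \<in> carrier G \<Longrightarrow> Vector_Spaces.linear (*s) (*s) (act g)"
    and one: "\<one>\<^bsub>G\<^esub> \<in> carrier G" "\<psi> \<one>\<^bsub>G\<^esub> = 1" "\<And>v. v \<in> M \<Longrightarrow> act \<one>\<^bsub>G\<^esub> v = v"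
  shows "isotypic G act M \<psi> = weight_space G act M \<psi>"
proof
  show "isotypic G act M \<psi> \<subseteq> weight_space G act M \<psi>"
    unfolding isotypic_def
  proof (rule vec.span_minimal[OF _ subspace_weight_space[OF M linear]], rule Union_least, clarify)
    fix S v assume "S \<subseteq> M" "v \<in> S" and irr: "irreducible_submodule G act S"
      and trace: "\<forall>g\<in>carrier G. trace_on S (act g) = \<psi> g"
    have "act g v = \<psi> g *s v" if "g \<in> carrier G" for g
      using irr trace linear one \<open>S \<subseteq> M\<close> that \<open>v \<in> S\<close>
      by (intro irreducible_submodule_degree_one[of G act S \<psi>]) auto
    then show "v \<in> weight_space G act M \<psi>"
      using \<open>v \<in> S\<close> \<open>S \<subseteq> M\<close> by (auto simp: weight_space_def)
  qed
next
  show "weight_space G act M \<psi> \<subseteq> isotypic G act M \<psi>"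
  proof
    fix v assume v: "v \<in> weight_space G act M \<psi>"
    show "v \<in> isotypic G act M \<psi>"
    proof (cases "v = 0")
      case True
      then show ?thesis by (simp add: isotypic_def vec.span_zero)
    next
      case False
      have act: "act g u = \<psi> g *s u" if "g \<in> carrier G" "u \<in> vec.span {v}" for g u
        using v that
        by (auto simp: weight_space_def vec.span_singleton vec.linear_scale[OF linear] mult.commute)
      have "vec.span {v} \<subseteq> M" using v M by (simp add: weight_space_def vec.span_minimal)
      moreover have "irreducible_submodule G act (vec.span {v})"
        using False act by (rule weight_line_irreducible_submodule)
      moreover have "\<forall>g\<in>carrier G. trace_on (vec.span {v}) (act g) = \<psi> g"
        using trace_on_line[OF False act] by blast
      moreover have "v \<in> vec.span {v}" by (simp add: vec.span_base)
      ultimately show ?thesis unfolding isotypic_def by (intro vec.span_base) blast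
    qed
  qed
qed

section \<open>Linear extension and orthogonal families\<close>

lemma subspace_free_space: "vec.subspace (free_space S)"
  by (simp add: free_space_def)

lemma free_space_mono: "S \<subseteq> T \<Longrightarrow> free_space S \<subseteq> free_space T"
  by (simp add: free_space_def vec.span_mono image_mono)

lemma bvec_in_free_space: "Z \<in> S \<Longrightarrow> bvec Z \<in> free_space S"
  by (simp add: free_space_def vec.span_base)

lemma free_space_nth_eq_0:
  assumes "v \<in> free_space S" "Z \<notin> S"
  shows "v $ Z = 0"
proof -
  have "vec.subspace {v :: complex ^ 'a. v $ Z = 0}" by (rule vec.subspaceI) auto
  then have "free_space S \<subseteq> {v. v $ Z = 0}"
    unfolding free_space_def using assms(2) by (intro vec.span_minimal) (auto simp: axis_def)
  then show ?thesis using assms(1) by blast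
qed

lemma linear_lin_ext: "Vector_Spaces.linear (*s) (*s) (lin_ext S f)"
  by unfold_locales
    (simp_all add: lin_ext_def vec.scale_left_distrib sum.distrib vec.scale_sum_right)

lemma linear_map_on_linear: "Vector_Spaces.linear (*s) (*s) f \<Longrightarrow> linear_map_on V f"
  by (simp add: linear_map_on_def vec.linear_add vec.linear_scale)

lemma lin_ext_bvec: "Y \<in> S \<Longrightarrow> lin_ext S f (bvec Y) = f Y"
  by (simp add: lin_ext_def axis_def if_distrib[of "\<lambda>x. x *s _"] cong: if_cong)

lemma lin_ext_cong: "(\<And>Y. Y \<in> S \<Longrightarrow> f Y = g Y) \<Longrightarrow> lin_ext S f v = lin_ext S g v"
  by (simp add: lin_ext_def)

lemma linear_eq_lin_ext:
  assumes "Vector_Spaces.linear (*s) (*s) g" "v \<in> free_space S"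
  shows "g v = lin_ext S (\<lambda>Y. g (bvec Y)) v"
  using assms(1) linear_lin_ext assms(2)[unfolded free_space_def]
  by (rule vec.linear_eq_on) (auto simp: lin_ext_bvec)

lemma linear_lin_ext_comp:
  assumes "Vector_Spaces.linear (*s) (*s) g"
  shows "g (lin_ext S f v) = lin_ext S (\<lambda>Y. g (f Y)) v"
  by (simp add: lin_ext_def vec.linear_sum[OF assms] vec.linear_scale[OF assms])

lemma lin_ext_subset:
  assumes "T \<subseteq> S" "v \<in> free_space T"
  shows "lin_ext S f v = lin_ext T f v"
  using linear_eq_lin_ext[OF linear_lin_ext assms(2), of S f] assms(1)
  by (simp add: lin_ext_bvec subset_iff cong: lin_ext_cong)

lemma image_lin_ext: "lin_ext S f ` free_space S = vec.span (f ` S)"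
proof -
  have "lin_ext S f ` bvec ` S = f ` S" by (simp add: image_image lin_ext_bvec)
  then show ?thesis
    unfolding free_space_def by (simp flip: vec.linear_span_image[OF linear_lin_ext])
qed

lemma lin_ext_in_subspace: "vec.subspace V \<Longrightarrow> (\<And>Y. Y \<in> S \<Longrightarrow> f Y \<in> V) \<Longrightarrow> lin_ext S f v \<in> V"
  unfolding lin_ext_def by (intro vec.subspace_sum vec.subspace_scale)

lemma ip_commute: "ip w v = cnj (ip v w)"
  by (simp add: ip_def mult.commute)

lemma ip_sum_left: "ip (\<Sum>x\<in>A. f x) v = (\<Sum>x\<in>A. ip (f x) v)"
  unfolding ip_def sum_component sum_distrib_right by (rule sum.swap)

lemma ip_scale_left: "ip (c *s u) v = c * ip u v"
  by (simp add: ip_def sum_distrib_left mult.assoc)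

lemma ip_sum_right: "ip v (\<Sum>x\<in>A. f x) = (\<Sum>x\<in>A. ip v (f x))"
  unfolding ip_commute[of v] by (simp add: ip_sum_left)

lemma ip_scale_right: "ip u (c *s v) = cnj c * ip u v"
  unfolding ip_commute[of u] by (simp add: ip_scale_left)

lemma ip_bvec_right: "ip v (bvec Z) = v $ Z"
  by (simp add: ip_def axis_def if_distrib cong: if_cong)

lemma ip_self_eq_0_iff: "ip v v = 0 \<longleftrightarrow> v = 0"
proof -
  have "ip v v = of_real (\<Sum>Y\<in>UNIV. (cmod (v $ Y))\<^sup>2)"
    by (simp add: ip_def flip: complex_norm_square)
  also have "\<dots> = 0 \<longleftrightarrow> v = 0"
    by (simp only: of_real_eq_0_iff)
      (simp add: sum_nonneg_eq_0_iff Finite_Cartesian_Product.vec_eq_iff)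
  finally show ?thesis .
qed

definition orthogonal_on :: "'b::finite set \<Rightarrow> ('b \<Rightarrow> complex ^ 'c::finite) \<Rightarrow> bool" where
  "orthogonal_on S f \<longleftrightarrow> pairwise (\<lambda>X Y. ip (f X) (f Y) = 0) S"

lemma ip_lin_ext_orthogonal:
  assumes "orthogonal_on S f" "X \<in> S"
  shows "ip (lin_ext S f v) (f X) = v $ X * ip (f X) (f X)"
proof -
  have "ip (lin_ext S f v) (f X) = (\<Sum>Y\<in>S. if Y = X then v $ X * ip (f X) (f X) else 0)"
    unfolding lin_ext_def ip_sum_left ip_scale_left
    using assms by (intro sum.cong) (auto simp: orthogonal_on_def pairwise_def)
  then show ?thesis using assms(2) by simp
qed

lemma ip_lin_ext_lin_ext_orthogonal:
  assumes orthogonal: "orthogonal_on S f" and norm: "\<And>X. X \<in> S \<Longrightarrow> ip (f X) (f X) = r"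
    and w: "w \<in> free_space S"
  shows "ip (lin_ext S f w) (lin_ext S f v) = r * ip w v"
proof -
  have "ip (lin_ext S f w) (lin_ext S f v) = (\<Sum>X\<in>S. cnj (v $ X) * (w $ X * r))"
    unfolding lin_ext_def[of S f v] ip_sum_right ip_scale_right
    by (intro sum.cong refl arg_cong[where f = "(*) _"])
      (simp add: ip_lin_ext_orthogonal[OF orthogonal] norm)
  also have "\<dots> = r * (\<Sum>X\<in>S. w $ X * cnj (v $ X))" by (simp add: sum_distrib_left mult_ac)
  also have "(\<Sum>X\<in>S. w $ X * cnj (v $ X)) = ip w v"
    unfolding ip_def by (rule sum.mono_neutral_left) (simp_all add: free_space_nth_eq_0[OF w])
  finally show ?thesis .
qed

lemma inj_on_lin_ext_orthogonal:
  assumes "orthogonal_on S f" and nonzero: "\<And>X. X \<in> S \<Longrightarrow> f X \<noteq> 0"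
  shows "inj_on (lin_ext S f) (free_space S)"
proof (rule inj_onI)
  fix u v assume u: "u \<in> free_space S" and v: "v \<in> free_space S"
    and eq: "lin_ext S f u = lin_ext S f v"
  have "u $ X = v $ X" for X
  proof (cases "X \<in> S")
    case True
    then have "u $ X * ip (f X) (f X) = v $ X * ip (f X) (f X)"
      using ip_lin_ext_orthogonal[OF assms(1) True] eq by metis
    then show ?thesis using nonzero[OF True] by (simp add: ip_self_eq_0_iff)
  qed (simp add: free_space_nth_eq_0[OF u] free_space_nth_eq_0[OF v])
  then show "u = v" by (simp add: Finite_Cartesian_Product.vec_eq_iff)
qed

lemma independent_orthogonal:
  assumes "orthogonal_on S f" "\<And>X. X \<in> S \<Longrightarrow> f X \<noteq> 0"
  shows "vec.independent (f ` S)"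
proof -
  have "vec.independent (bvec ` S)"
    by (rule vec.independent_mono[OF vec.independent_Basis]) (auto simp: cart_basis_def)
  then have "vec.independent (lin_ext S f ` bvec ` S)"
    using inj_on_lin_ext_orthogonal[OF assms] unfolding free_space_def
    by (rule vec.linear_independent_injective_image[OF linear_lin_ext])
  then show ?thesis by (simp add: image_image lin_ext_bvec)
qed

lemma pair_isoI:
  assumes V: "operator_on V f" and "vec.subspace W" "linear_map_on W g"
    and \<theta>: "linear_map_on V \<theta>" "bij_betw \<theta> V W"
    and intertwining: "\<And>v. v \<in> V \<Longrightarrow> \<theta> (f v) = g (\<theta> v)"
  shows "pair_iso V f W g \<theta>"
proof -
  have "g (\<theta> v) \<in> W" if "v \<in> V" for v
  proof -
    have "f v \<in> V" using V that by (auto simp: operator_on_def)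
    then show ?thesis
      unfolding intertwining[OF that, symmetric] using \<theta>(2) by (auto dest: bij_betwE)
  qed
  then have "g ` W \<subseteq> W" using bij_betw_imp_surj_on[OF \<theta>(2)] by auto
  then show ?thesis using assms by (simp add: pair_iso_def operator_on_def)
qed

lemma linear_up_op: "Vector_Spaces.linear (*s) (*s) (up_op X)"
  unfolding up_op_def by (rule linear_lin_ext)

lemma up_op_bvec: "Y \<in> Bq X \<Longrightarrow> up_op X (bvec Y) = (\<Sum>Z | covers_in (Bq X) Z Y. bvec Z)"
  by (simp add: up_op_def lin_ext_bvec)

lemma up_op_in_free_space: "up_op X v \<in> free_space (Bq X)"
  unfolding up_op_def
  by (intro lin_ext_in_subspace vec.subspace_sum subspace_free_space bvec_in_free_space)
    (simp add: covers_in_def)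

section \<open>Subspaces not contained in the hyperplane\<close>

definition emb :: "'a::field ^ 'n::finite \<Rightarrow> 'a ^ 'n option" where
  "emb a = (\<chi> i. case i of None \<Rightarrow> 0 | Some j \<Rightarrow> a $ j)"

lemma emb_nth [simp]: "emb a $ None = 0" "emb a $ Some j = a $ j"
  by (simp_all add: emb_def)

lemma vec_option_eq_iff:
  "(x :: 'a ^ 'n::finite option) = y \<longleftrightarrow> x $ None = y $ None \<and> (\<forall>j. x $ Some j = y $ Some j)"
  by (metis (no_types) Finite_Cartesian_Product.vec_eq_iff option.exhaust)

lemma emb_simps [simp]:
  "emb 0 = 0" "emb (a + b) = emb a + emb b" "emb (- a) = - emb a" "emb (a - b) = emb a - emb b"
  "emb (c *s a) = c *s emb a" "emb a = emb b \<longleftrightarrow> a = b"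
  by (auto simp: vec_option_eq_iff Finite_Cartesian_Product.vec_eq_iff)

lemma Fqn_eq_range_emb: "Fqn = range emb"
proof -
  have "x = emb (\<chi> j. x $ Some j)" if "x $ None = 0"
    for x :: "'a::{field,finite} ^ 'n::finite option"
    using that by (simp add: vec_option_eq_iff)
  then show ?thesis by (auto simp: Fqn_def image_iff)
qed

lemma mem_Fqn: "y \<in> Fqn \<longleftrightarrow> y $ None = 0"
  by (simp add: Fqn_def)

lemma subspace_Fqn: "vec.subspace Fqn"
  by (rule vec.subspaceI) (simp_all add: mem_Fqn)

lemma Bq_subspace: "X \<in> Bq V \<Longrightarrow> vec.subspace X"
  by (simp add: Bq_def)

lemma Bq_FqnD: "X \<in> Bq Fqn \<Longrightarrow> x \<in> X \<Longrightarrow> x $ None = 0"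
  by (auto simp: Bq_def Fqn_def)

lemma Int_Fqn_in_Bq: "vec.subspace Z \<Longrightarrow> Z \<inter> Fqn \<in> Bq Fqn"
  by (simp add: Bq_def vec.subspace_inter subspace_Fqn)

lemma mem_Aq: "Z \<in> Aq \<longleftrightarrow> vec.subspace Z \<and> \<not> Z \<subseteq> Fqn"
  by (auto simp: Aq_def Bq_def)

lemma Aq_Int_Fqn: "Z \<in> Aq \<Longrightarrow> Z \<inter> Fqn \<in> Bq Fqn"
  by (simp add: mem_Aq Int_Fqn_in_Bq)

lemma subspace_vimage_emb: "vec.subspace X \<Longrightarrow> vec.subspace (emb -` X)"
  by (simp add: vec.subspace_def)

lemma card_vimage_emb: "X \<in> Bq Fqn \<Longrightarrow> card (emb -` X) = card X"
  by (rule card_vimage_inj) (auto simp: inj_def Bq_def Fqn_eq_range_emb)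

definition translate ::
  "'a::{field,finite} ^ 'n::finite \<Rightarrow> ('a ^ 'n option) set \<Rightarrow> ('a ^ 'n option) set" where
  "translate a Z = (\<lambda>y. H_mat a *v y) ` Z"

lemma H_mat_mult_vec: "H_mat a *v y = y + y $ None *s emb a"
proof -
  have "(H_mat a *v y) $ i = (y + y $ None *s emb a) $ i" for i
    by (cases i) (simp_all add: matrix_vector_mult_def H_mat_def UNIV_option_conv sum.reindex
        if_distrib[of "\<lambda>x. x * _"] add.commute cong: if_cong)
  then show ?thesis by (simp add: Finite_Cartesian_Product.vec_eq_iff)
qed

lemma H_mat_0: "H_mat 0 = Finite_Cartesian_Product.mat 1"
  by (simp add: matrix_eq H_mat_mult_vec)

lemma H_mat_add: "H_mat a ** H_mat b = H_mat (a + b)"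
proof -
  have "(H_mat a ** H_mat b) *v y = H_mat (a + b) *v y" for y
    unfolding matrix_vector_mul_assoc[symmetric]
    by (simp add: H_mat_mult_vec vec.scale_right_distrib algebra_simps)
  then show ?thesis by (simp add: matrix_eq)
qed

lemma inj_H_mat: "inj H_mat"
proof (rule injI)
  fix a b assume "H_mat a = H_mat b"
  then have "H_mat a *v axis None 1 = H_mat b *v axis None 1" by simp
  then show "a = b" by (simp add: H_mat_mult_vec)
qed

lemma mem_translate: "y \<in> translate a Z \<longleftrightarrow> y - y $ None *s emb a \<in> Z"
proof
  assume "y - y $ None *s emb a \<in> Z"
  moreover have "y = H_mat a *v (y - y $ None *s emb a)" by (simp add: H_mat_mult_vec)
  ultimately show "y \<in> translate a Z" unfolding translate_def by (rule rev_image_eqI)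
qed (auto simp: translate_def H_mat_mult_vec)

lemma translate_0 [simp]: "translate 0 Z = Z"
  by (simp add: translate_def H_mat_0)

lemma translate_translate [simp]: "translate a (translate b Z) = translate (a + b) Z"
  by (simp add: translate_def image_image matrix_vector_mul_assoc H_mat_add)

lemma translate_eq_iff: "translate a Y = translate b Z \<longleftrightarrow> translate (a - b) Y = Z"
proof
  assume "translate a Y = translate b Z"
  then have "translate (- b) (translate a Y) = translate (- b) (translate b Z)" by simp
  then show "translate (a - b) Y = Z" by simp
next
  assume "translate (a - b) Y = Z"
  then have "translate b (translate (a - b) Y) = translate b Z" by simp
  then show "translate a Y = translate b Z" by simp
qed

lemma translate_Int_Fqn [simp]: "translate a Z \<inter> Fqn = Z \<inter> Fqn"
  by (auto simp: mem_translate mem_Fqn)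

lemma subspace_translate: "vec.subspace Z \<Longrightarrow> vec.subspace (translate a Z)"
  unfolding translate_def by (rule vec.subspace_image)

lemma dim_translate: "vec.dim (translate a Z) = vec.dim Z"
  unfolding translate_def
proof (rule vec.dim_image_eq[OF matrix_vector_mul_linear_gen], rule inj_onI)
  fix x y :: "'a ^ 'b option" assume eq: "H_mat a *v x = H_mat a *v y"
  have "H_mat (- a) *v (H_mat a *v z) = z" for z :: "'a ^ 'b option"
    by (simp add: matrix_vector_mul_assoc H_mat_add H_mat_0)
  then show "x = y" using eq by metis
qed

lemma translate_in_Aq:
  assumes "Z \<in> Aq"
  shows "translate a Z \<in> Aq"
proof -
  obtain z where "z \<in> Z" "z \<notin> Fqn" using assms by (auto simp: mem_Aq)
  then have "H_mat a *v z \<in> translate a Z" "H_mat a *v z \<notin> Fqn"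
    by (simp_all add: translate_def mem_Fqn H_mat_mult_vec)
  then show ?thesis using assms by (auto simp: mem_Aq subspace_translate)
qed

lemma subspace_hat: "vec.subspace (hat X)"
  by (simp add: hat_def)

lemma mem_hat: "X \<in> Bq Fqn \<Longrightarrow> y \<in> hat X \<longleftrightarrow> y - y $ None *s axis None 1 \<in> X"
  unfolding hat_def
  by (auto simp: vec.span_insert Bq_subspace vec.span_eq_iff[THEN iffD2] dest: Bq_FqnD)

lemma hat_Int_Fqn: "X \<in> Bq Fqn \<Longrightarrow> hat X \<inter> Fqn = X"
  by (auto simp: mem_hat mem_Fqn Bq_FqnD[of X])

lemma hat_in_Aq:
  assumes "X \<in> Bq Fqn"
  shows "hat X \<in> Aq"
proof -
  have "axis None 1 \<in> hat X" unfolding hat_def by (intro vec.span_base) simp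
  then show ?thesis by (auto simp: mem_Aq mem_Fqn subspace_hat)
qed

lemma dim_hat:
  assumes "X \<in> Bq Fqn"
  shows "vec.dim (hat X) = Suc (vec.dim X)"
proof -
  have "axis None 1 \<notin> vec.span X"
    using assms by (auto simp: Bq_subspace vec.span_eq_iff[THEN iffD2] dest: Bq_FqnD)
  then show ?thesis by (simp add: hat_def vec.dim_insert)
qed

lemma translate_hat_mono: "X \<subseteq> Y \<Longrightarrow> translate a (hat X) \<subseteq> translate a (hat Y)"
  unfolding translate_def hat_def by (intro image_mono vec.span_mono) auto

lemma translate_hat_Int_Fqn: "X \<in> Bq Fqn \<Longrightarrow> translate a (hat X) \<inter> Fqn = X"
  by (simp add: hat_Int_Fqn)

lemma dim_translate_hat: "X \<in> Bq Fqn \<Longrightarrow> vec.dim (translate a (hat X)) = Suc (vec.dim X)"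
  by (simp add: dim_translate dim_hat)

lemma point_in_translate_hat:
  "X \<in> Bq Fqn \<Longrightarrow> emb a + axis None 1 \<in> translate a (hat X)"
  by (simp add: mem_translate mem_hat Bq_subspace vec.subspace_0)

lemma subspace_diff_mem_iff:
  assumes "vec.subspace S" "w \<in> S"
  shows "x - w \<in> S \<longleftrightarrow> x \<in> S"
  using vec.subspace_add[OF assms(1), of "x - w" w] vec.subspace_diff[OF assms(1), of x w] assms(2)
  by auto

lemma translate_hat_fixed_iff:
  assumes X: "X \<in> Bq Fqn" and Y: "Y \<in> Bq Fqn"
  shows "translate a (hat Y) = hat X \<longleftrightarrow> X = Y \<and> a \<in> emb -` Y"
proof -
  have "translate a (hat Y) = hat Y \<longleftrightarrow> emb a \<in> Y"
  proof
    assume "translate a (hat Y) = hat Y"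
    then have "emb a + axis None 1 \<in> hat Y" using point_in_translate_hat[OF Y, of a] by simp
    then show "emb a \<in> Y" using Y by (simp add: mem_hat)
  next
    assume "emb a \<in> Y"
    then have "y $ None *s emb a \<in> Y" for y :: "'a ^ 'b option"
      by (intro vec.subspace_scale[OF Bq_subspace[OF Y]])
    then have "y - y $ None *s axis None 1 - y $ None *s emb a \<in> Y \<longleftrightarrow>
        y - y $ None *s axis None 1 \<in> Y" for y
      by (intro subspace_diff_mem_iff[OF Bq_subspace[OF Y]])
    then show "translate a (hat Y) = hat Y"
      using Y by (simp add: Set.set_eq_iff mem_translate mem_hat diff_diff_eq add.commute)
  qed
  moreover have "X = Y" if "translate a (hat Y) = hat X"
    using that translate_hat_Int_Fqn[OF Y, of a] hat_Int_Fqn[OF X] by simp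
  ultimately show ?thesis by auto
qed

lemma subspace_eq_translate_hat:
  assumes Z: "vec.subspace Z" and point: "emb a + axis None 1 \<in> Z"
  shows "Z = translate a (hat (Z \<inter> Fqn))"
proof (rule Set.set_eqI)
  fix y
  have "y - y $ None *s (emb a + axis None 1) \<in> Z \<longleftrightarrow> y \<in> Z"
    using Z point by (intro subspace_diff_mem_iff vec.subspace_scale)
  then show "y \<in> Z \<longleftrightarrow> y \<in> translate a (hat (Z \<inter> Fqn))"
    by (simp add: mem_translate mem_hat[OF Int_Fqn_in_Bq[OF Z]] mem_Fqn vec.scale_right_distrib
        diff_diff_eq)
qed

lemma Aq_eq_translate_hat:
  assumes "Z \<in> Aq"
  shows "\<exists>a. Z = translate a (hat (Z \<inter> Fqn))"
proof -
  from assms obtain z where Z: "vec.subspace Z" and z: "z \<in> Z" "z $ None \<noteq> 0"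
    by (auto simp: mem_Aq subset_iff mem_Fqn)
  let ?w = "inverse (z $ None) *s z"
  have "?w - axis None 1 \<in> Fqn" using z(2) by (simp add: mem_Fqn)
  then obtain a where "?w - axis None 1 = emb a" by (auto simp: Fqn_eq_range_emb)
  then have "emb a + axis None 1 = ?w" by (simp add: diff_eq_eq)
  moreover have "?w \<in> Z" using Z z(1) by (rule vec.subspace_scale)
  ultimately show ?thesis using subspace_eq_translate_hat[OF Z, of a] by auto
qed

lemma dim_Aq:
  assumes "Z \<in> Aq"
  shows "vec.dim Z = Suc (vec.dim (Z \<inter> Fqn))"
  using Aq_eq_translate_hat[OF assms] dim_translate_hat[OF Aq_Int_Fqn[OF assms]] by metis

lemma covers_in_translate_hat_iff:
  assumes Y: "Y \<in> Bq Fqn"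
  shows "covers_in (Bq UNIV) Z (translate a (hat Y)) \<longleftrightarrow>
    (\<exists>X. covers_in (Bq Fqn) X Y \<and> Z = translate a (hat X))"
proof
  assume "covers_in (Bq UNIV) Z (translate a (hat Y))"
  then have Z: "vec.subspace Z" "translate a (hat Y) \<subset> Z"
    and dim: "vec.dim Z = Suc (vec.dim (translate a (hat Y)))"
    by (simp_all add: covers_in_Bq_iff_dim)
  let ?X = "Z \<inter> Fqn"
  have X: "?X \<in> Bq Fqn" using Z(1) by (rule Int_Fqn_in_Bq)
  have Z_eq: "Z = translate a (hat ?X)"
    using point_in_translate_hat[OF Y] Z by (intro subspace_eq_translate_hat) auto
  have "vec.dim ?X = Suc (vec.dim Y)"
    using dim dim_translate_hat[OF X, of a] dim_translate_hat[OF Y, of a] Z_eq by simp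
  moreover have "Y \<subseteq> ?X" using Z(2) translate_hat_Int_Fqn[OF Y, of a] by blast
  ultimately have "covers_in (Bq Fqn) ?X Y"
    using X Y by (auto simp: covers_in_Bq_iff_dim Bq_subspace)
  then show "\<exists>X. covers_in (Bq Fqn) X Y \<and> Z = translate a (hat X)" using Z_eq by blast
next
  assume "\<exists>X. covers_in (Bq Fqn) X Y \<and> Z = translate a (hat X)"
  then obtain X where "covers_in (Bq Fqn) X Y" and Z: "Z = translate a (hat X)" by blast
  then have X: "X \<in> Bq Fqn" "Y \<subseteq> X" "vec.dim X = Suc (vec.dim Y)"
    unfolding covers_in_Bq_iff_dim by (auto simp: Bq_def)
  have "vec.dim Z = Suc (vec.dim (translate a (hat Y)))"
    using X Y by (simp add: Z dim_translate_hat)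
  moreover have "translate a (hat Y) \<subseteq> Z" unfolding Z using X(2) by (rule translate_hat_mono)
  ultimately show "covers_in (Bq UNIV) Z (translate a (hat Y))"
    by (auto simp: covers_in_Bq_iff_dim Z subspace_translate subspace_hat)
qed

lemma covers_in_UNIV_iff:
  assumes X: "X \<in> Bq Fqn"
  shows "covers_in (Bq UNIV) Z X \<longleftrightarrow> covers_in (Bq Fqn) Z X \<or> (Z \<in> Aq \<and> Z \<inter> Fqn = X)"
proof (cases "Z \<in> Aq")
  case False
  then show ?thesis by (auto simp: covers_in_Bq_iff_dim mem_Aq)
next
  case True
  then have Z: "vec.subspace Z" "\<not> Z \<subseteq> Fqn" by (simp_all add: mem_Aq)
  have "X \<subset> Z \<and> vec.dim Z = Suc (vec.dim X) \<longleftrightarrow> Z \<inter> Fqn = X"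
  proof
    assume "X \<subset> Z \<and> vec.dim Z = Suc (vec.dim X)"
    moreover from this have "X \<subseteq> Z \<inter> Fqn" using X by (auto simp: Bq_def)
    ultimately show "Z \<inter> Fqn = X"
      using dim_Aq[OF True]
        vec.subspace_dim_equal[OF Bq_subspace[OF X] Bq_subspace[OF Int_Fqn_in_Bq[OF Z(1)]]]
      by simp
  qed (use Z dim_Aq[OF True] in auto)
  then show ?thesis using X True Z by (auto simp: covers_in_Bq_iff_dim Bq_subspace)
qed

section \<open>The action of the translation group\<close>

lemma carrier_H_group: "carrier H_group = range H_mat"
  by (simp add: H_group_def)

lemma mult_H_group: "H_mat a \<otimes>\<^bsub>H_group\<^esub> H_mat b = H_mat (a + b)"
  by (simp add: H_group_def GL_group_def H_mat_add)

lemma one_H_group: "\<one>\<^bsub>H_group\<^esub> = H_mat 0"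
  by (simp add: H_group_def GL_group_def H_mat_0)

lemma comm_monoid_H_group: "comm_monoid H_group"
  by (rule comm_monoidI) (auto simp: carrier_H_group mult_H_group one_H_group add_ac)

definition H_char :: "'a::{field,finite} ^ 'n::finite \<Rightarrow> 'a ^ 'n option ^ 'n option \<Rightarrow> complex" where
  "H_char b = (\<lambda>g\<in>carrier H_group. vchar b (\<chi> i. g $ Some i $ None))"

lemma H_char_H_mat [simp]: "H_char b (H_mat a) = vchar b a"
  by (simp add: H_char_def carrier_H_group H_mat_def vec_nth_inverse)

lemma H_char_inj: "H_char b = H_char c \<Longrightarrow> b = c"
  by (rule vchar_inj) (metis H_char_H_mat)

lemma trivial_char_H_group: "trivial_char H_group = H_char 0"
  by (simp add: trivial_char_def H_char_def)

lemma irr_chars_H_group: "irr_chars H_group = range H_char"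
  unfolding irr_chars_comm_monoid[OF comm_monoid_H_group]
proof (intro subset_antisym subsetI)
  fix \<psi> :: "'a::{field,finite} ^ 'n::finite option ^ 'n option \<Rightarrow> complex"
  assume "\<psi> \<in> linear_chars H_group"
  then have extensional: "\<psi> \<in> extensional (carrier H_group)" and one: "\<psi> (H_mat 0) = 1"
    and mult: "\<And>a b. \<psi> (H_mat (a + b)) = \<psi> (H_mat a) * \<psi> (H_mat b)"
    by (auto simp: linear_chars_def one_H_group carrier_H_group mult_H_group)
  obtain b where "(\<lambda>a. \<psi> (H_mat a)) = vchar b"
    using character_eq_vchar[of "\<lambda>a. \<psi> (H_mat a)"] one mult by auto
  then have "\<psi> (H_mat a) = H_char b (H_mat a)" for a by (metis H_char_H_mat)
  then have "\<psi> = H_char b"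
    by (intro extensionalityI[OF extensional]) (auto simp: H_char_def carrier_H_group)
  then show "\<psi> \<in> range H_char" by blast
next
  fix \<psi> :: "'a::{field,finite} ^ 'n::finite option ^ 'n option \<Rightarrow> complex"
  assume "\<psi> \<in> range H_char"
  then obtain b where \<psi>: "\<psi> = H_char b" by blast
  have "\<psi> \<in> extensional (carrier H_group)" by (simp add: \<psi> H_char_def)
  then show "\<psi> \<in> linear_chars H_group"
    by (auto simp: linear_chars_def \<psi> one_H_group carrier_H_group mult_H_group add_char_add)
qed

lemma H_act_H_mat: "H_act (H_mat a) = lin_ext Aq (\<lambda>Z. bvec (translate a Z))"
  by (simp add: H_act_def translate_def)

lemma linear_H_act: "Vector_Spaces.linear (*s) (*s) (H_act g)"
  unfolding H_act_def by (rule linear_lin_ext)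

lemma H_act_bvec: "Z \<in> Aq \<Longrightarrow> H_act (H_mat a) (bvec Z) = bvec (translate a Z)"
  by (simp add: H_act_H_mat lin_ext_bvec)

lemma H_act_H_act: "H_act (H_mat a) (H_act (H_mat b) v) = H_act (H_mat (a + b)) v"
  unfolding H_act_H_mat[of b] H_act_H_mat[of "a + b"] linear_lin_ext_comp[OF linear_H_act]
  by (rule lin_ext_cong) (simp add: H_act_bvec translate_in_Aq)

lemma H_act_0: "v \<in> free_space Aq \<Longrightarrow> H_act (H_mat 0) v = v"
  by (simp add: H_act_H_mat flip: linear_eq_lin_ext[OF vec.linear_ident])

lemma H_act_nth_translate:
  assumes "Z \<in> Aq"
  shows "H_act (H_mat a) v $ translate a Z = v $ Z"
proof -
  have "H_act (H_mat a) v $ translate a Z = (\<Sum>X\<in>Aq. if X = Z then v $ Z else 0)"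
    unfolding H_act_H_mat lin_ext_def sum_component
    by (intro sum.cong) (auto simp: axis_def translate_eq_iff)
  then show ?thesis using assms by simp
qed

lemma H_act_in_free_space:
  assumes "T \<subseteq> Aq" "\<And>Z. Z \<in> T \<Longrightarrow> translate a Z \<in> T" "v \<in> free_space T"
  shows "H_act (H_mat a) v \<in> free_space T"
  unfolding H_act_H_mat lin_ext_subset[OF assms(1,3)]
  using assms(2) by (intro lin_ext_in_subspace subspace_free_space bvec_in_free_space)

lemma mem_weight_space_H_char:
  "v \<in> weight_space H_group H_act M (H_char b) \<longleftrightarrow> v \<in> M \<and> (\<forall>a. H_act (H_mat a) v = vchar b a *s v)"
  by (simp add: weight_space_def carrier_H_group)

lemma isotypic_H_char:
  assumes "T \<subseteq> Aq"
  shows "isotypic H_group H_act (free_space T) (H_char b) =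
    weight_space H_group H_act (free_space T) (H_char b)"
proof (rule isotypic_eq_weight_space)
  show "H_act \<one>\<^bsub>H_group\<^esub> v = v" if "v \<in> free_space T" for v
    using that free_space_mono[OF assms] by (auto simp: one_H_group H_act_0)
qed (simp_all add: subspace_free_space linear_H_act one_H_group carrier_H_group)

lemma char_proj_H_char: "char_proj (H_char b) v = (\<Sum>a\<in>UNIV. vchar b (- a) *s H_act (H_mat a) v)"
  by (simp add: char_proj_def carrier_H_group sum.reindex inj_H_mat cnj_add_char)

lemma linear_char_proj: "Vector_Spaces.linear (*s) (*s) (char_proj (H_char b))"
  unfolding char_proj_H_char
  by (intro vec.linear_compose_sum ballI vec.linear_compose_scale_right linear_H_act)

lemma H_act_char_proj:
  "H_act (H_mat c) (char_proj (H_char b) v) = vchar b c *s char_proj (H_char b) v"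
proof -
  have "H_act (H_mat c) (char_proj (H_char b) v) =
      (\<Sum>a\<in>UNIV. vchar b (- a) *s H_act (H_mat (c + a)) v)"
    by (simp add: char_proj_H_char H_act_H_act vec.linear_sum[OF linear_H_act]
        vec.linear_scale[OF linear_H_act])
  also have "\<dots> = (\<Sum>a\<in>UNIV. vchar b (c + - a) *s H_act (H_mat a) v)"
    by (rule sum.reindex_bij_witness[of _ "\<lambda>a. a - c" "\<lambda>a. c + a"]) auto
  also have "\<dots> = vchar b c *s char_proj (H_char b) v"
    unfolding char_proj_H_char vec.scale_sum_right
    by (intro sum.cong) (simp_all only: scalar_product_simps add_char_add vector_smult_assoc)
  finally show ?thesis .
qed

lemma char_proj_H_act:
  "char_proj (H_char b) (H_act (H_mat c) v) = vchar b c *s char_proj (H_char b) v"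
proof -
  have "char_proj (H_char b) (H_act (H_mat c) v) = H_act (H_mat c) (char_proj (H_char b) v)"
    by (simp add: char_proj_H_char H_act_H_act vec.linear_sum[OF linear_H_act]
        vec.linear_scale[OF linear_H_act] add.commute)
  then show ?thesis by (simp only: H_act_char_proj)
qed

lemma char_proj_weight_space:
  fixes b :: "'a::{field,finite} ^ 'n::finite"
  assumes "v \<in> weight_space H_group H_act M (H_char b)"
  shows "char_proj (H_char b) v = of_nat (CARD('a) ^ CARD('n)) *s v"
proof -
  have "vchar b (- a) *s H_act (H_mat a) v = v" for a
    using assms by (simp add: mem_weight_space_H_char mult.commute[of "add_char (- _)"])
  then show ?thesis by (simp add: char_proj_H_char vec.sum_constant_scale del: sum_constant)
qed

lemma weight_space_eq_image_char_proj:
  fixes b :: "'a::{field,finite} ^ 'n::finite"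
  assumes T: "T \<subseteq> Aq" "\<And>a Z. Z \<in> T \<Longrightarrow> translate a Z \<in> T"
  shows "weight_space H_group H_act (free_space T) (H_char b) = char_proj (H_char b) ` free_space T"
proof (intro subset_antisym subsetI)
  fix v assume v: "v \<in> weight_space H_group H_act (free_space T) (H_char b)"
  let ?u = "inverse (of_nat (CARD('a) ^ CARD('n))) *s v"
  have "v = char_proj (H_char b) ?u"
    by (simp add: vec.linear_scale[OF linear_char_proj] char_proj_weight_space[OF v])
  moreover have "?u \<in> free_space T"
    using v by (intro vec.subspace_scale subspace_free_space) (simp add: weight_space_def)
  ultimately show "v \<in> char_proj (H_char b) ` free_space T" by (rule image_eqI)
next
  fix w assume "w \<in> char_proj (H_char b) ` free_space T"
  then obtain v where v: "v \<in> free_space T" and w: "w = char_proj (H_char b) v" by blast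
  have "w \<in> free_space T"
    unfolding w char_proj_H_char
    by (intro vec.subspace_sum vec.subspace_scale subspace_free_space H_act_in_free_space T v)
  then show "w \<in> weight_space H_group H_act (free_space T) (H_char b)"
    by (simp add: mem_weight_space_H_char w H_act_char_proj)
qed

section \<open>Projections of the subspaces containing the last basis vector\<close>

abbreviation hat_proj ::
  "'a::{field,finite} ^ 'n::finite \<Rightarrow> ('a ^ 'n option) set \<Rightarrow> complex ^ (('a ^ 'n option) set)" where
  "hat_proj b X \<equiv> char_proj (H_char b) (bvec (hat X))"

lemma hat_proj_eq_sum:
  "X \<in> Bq Fqn \<Longrightarrow> hat_proj b X = (\<Sum>a\<in>UNIV. vchar b (- a) *s bvec (translate a (hat X)))"
  by (simp add: char_proj_H_char H_act_bvec hat_in_Aq)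

lemma char_proj_translate_hat:
  assumes "X \<in> Bq Fqn"
  shows "char_proj (H_char b) (bvec (translate a (hat X))) = vchar b a *s hat_proj b X"
  using char_proj_H_act[of b a "bvec (hat X)"] by (simp add: H_act_bvec hat_in_Aq[OF assms])

lemma char_proj_Aq_equiv:
  assumes "X \<in> Aq" "Y \<in> Aq" "Aq_equiv X Y"
  shows "\<exists>c. c \<noteq> 0 \<and> char_proj (H_char b) (bvec X) = c *s char_proj (H_char b) (bvec Y)"
proof -
  let ?Z = "X \<inter> Fqn"
  have "?Z \<in> Bq Fqn" using assms(1) by (rule Aq_Int_Fqn)
  moreover obtain a c where "X = translate a (hat ?Z)" "Y = translate c (hat ?Z)"
    using assms Aq_eq_translate_hat unfolding Aq_equiv_def by metis
  ultimately have "char_proj (H_char b) (bvec X) = vchar b a *s hat_proj b ?Z"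
    "char_proj (H_char b) (bvec Y) = vchar b c *s hat_proj b ?Z"
    by (metis char_proj_translate_hat)+
  then have "char_proj (H_char b) (bvec X) =
      (vchar b a / vchar b c) *s char_proj (H_char b) (bvec Y)"
    by simp
  then show ?thesis by (intro exI[of _ "vchar b a / vchar b c"]) simp
qed

definition over ::
  "('a::{field,finite} ^ 'n::finite option) set set \<Rightarrow> ('a ^ 'n option) set set" where
  "over T = {Z \<in> Aq. Z \<inter> Fqn \<in> T}"

lemma rank_part_subset: "rank_part P k \<subseteq> P"
  by (auto simp: rank_part_def)

lemma over_Bq_Fqn: "over (Bq Fqn) = Aq"
  by (auto simp: over_def Aq_Int_Fqn)

lemma over_rank_part: "over (rank_part (Bq Fqn) k) = rank_part Aq (Suc k)"
  by (auto simp: over_def rank_part_def dim_Aq Aq_Int_Fqn)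

lemma weight_space_over_eq_span:
  assumes T: "T \<subseteq> Bq Fqn"
  shows "weight_space H_group H_act (free_space (over T)) (H_char b) = vec.span (hat_proj b ` T)"
proof -
  have "weight_space H_group H_act (free_space (over T)) (H_char b) =
      char_proj (H_char b) ` free_space (over T)"
    by (rule weight_space_eq_image_char_proj) (auto simp: over_def translate_in_Aq)
  also have "\<dots> = vec.span (char_proj (H_char b) ` bvec ` over T)"
    unfolding free_space_def by (simp only: vec.linear_span_image[OF linear_char_proj])
  also have "\<dots> = vec.span (hat_proj b ` T)"
    unfolding vec.span_eq image_image
  proof (intro conjI image_subsetI)
    fix Z assume "Z \<in> over T"
    then obtain X a where X: "X \<in> T" "Z = translate a (hat X)"
      using Aq_eq_translate_hat unfolding over_def by blast
    then have "char_proj (H_char b) (bvec Z) = vchar b a *s hat_proj b X"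
      using T by (auto simp: char_proj_translate_hat)
    then show "char_proj (H_char b) (bvec Z) \<in> vec.span (hat_proj b ` T)"
      using X(1) by (auto intro: vec.span_scale vec.span_base)
  next
    fix X assume "X \<in> T"
    then have "hat X \<in> over T" using T by (auto simp: over_def hat_in_Aq hat_Int_Fqn)
    then show "hat_proj b X \<in> vec.span ((\<lambda>Z. char_proj (H_char b) (bvec Z)) ` over T)"
      by (intro vec.span_base imageI)
  qed
  finally show ?thesis .
qed

lemma W_iso_H_char: "W_iso (H_char b) = vec.span (hat_proj b ` Bq Fqn)"
  unfolding W_iso_def isotypic_H_char[OF order_refl]
  using weight_space_over_eq_span[of "Bq Fqn" b] by (simp add: over_Bq_Fqn)

lemma W_rank_H_char: "W_rank (H_char b) (Suc k) = vec.span (hat_proj b ` rank_part (Bq Fqn) k)"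
  unfolding W_rank_def isotypic_H_char[OF rank_part_subset]
  unfolding over_rank_part[symmetric]
  by (rule weight_space_over_eq_span[OF rank_part_subset])

definition perp :: "'a::{field,finite} ^ 'n::finite \<Rightarrow> ('a ^ 'n option) set" where
  "perp b = emb ` annihilator {b}"

lemma subset_perp_iff: "X \<in> Bq Fqn \<Longrightarrow> X \<subseteq> perp b \<longleftrightarrow> b \<in> annihilator (emb -` X)"
  by (auto simp: perp_def annihilator_def Bq_def Fqn_eq_range_emb scalar_product_commute[of _ b]
      image_iff subset_iff)

lemma perp_0: "perp 0 = Fqn"
  by (simp add: perp_def annihilator_def Fqn_eq_range_emb scalar_product_commute[of _ 0])

lemma perp_in_Bq: "perp b \<in> Bq Fqn"
proof -
  have "Vector_Spaces.linear (*s) (*s) (emb :: 'a ^ 'b \<Rightarrow> _)" by unfold_locales simp_all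
  then show ?thesis
    using vec.linear_subspace_image[OF _ subspace_annihilator]
    by (auto simp: perp_def Bq_def Fqn_eq_range_emb)
qed

lemma perp_subset_Fqn: "perp b \<subseteq> Fqn"
  using perp_in_Bq[of b] by (simp add: Bq_def)

lemma Bq_perp: "Y \<in> Bq (perp b) \<longleftrightarrow> Y \<in> Bq Fqn \<and> Y \<subseteq> perp b"
  using perp_in_Bq[of b] by (auto simp: Bq_def)

lemma dim_perp:
  fixes b :: "'a::{field,finite} ^ 'n::finite"
  assumes "b \<noteq> 0"
  shows "vec.dim (perp b) = CARD('n) - 1"
proof -
  have "card (perp b) = card (annihilator (vec.span {b}))"
    unfolding perp_def annihilator_span by (rule card_image) (simp add: inj_on_def)
  moreover have "card (vec.span {b}) = CARD('a)"
    using assms by (simp add: card_span_independent)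
  ultimately have "card (perp b) * CARD('a) = CARD('a) ^ CARD('n)"
    using card_annihilator_mult_card[of "vec.span {b}"] by simp
  also have "\<dots> = CARD('a) ^ (CARD('n) - 1) * CARD('a)"
    by (metis Suc_pred' power_Suc2 zero_less_card_finite)
  finally show ?thesis by (simp add: dim_eq_iff_card_eq[OF Bq_subspace[OF perp_in_Bq]])
qed

lemma hat_proj_nth_hat:
  assumes X: "X \<in> Bq Fqn" and Y: "Y \<in> Bq Fqn"
  shows "hat_proj b Y $ hat X = (if X = Y \<and> Y \<subseteq> perp b then of_nat (card Y) else 0)"
proof -
  have "bvec (translate a (hat Y)) $ hat X = (if X = Y \<and> a \<in> emb -` Y then 1 else 0)" for a
    unfolding axis_def using translate_hat_fixed_iff[OF X Y, of a] by (simp add: eq_commute)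
  then have "hat_proj b Y $ hat X = (\<Sum>a\<in>UNIV. if X = Y \<and> a \<in> emb -` Y then cnj (vchar b a) else 0)"
    unfolding hat_proj_eq_sum[OF Y] sum_component vector_smult_component
    by (intro sum.cong) (simp_all add: cnj_add_char)
  also have "\<dots> = (if X = Y then cnj (\<Sum>a\<in>emb -` Y. vchar b a) else 0)"
    by (simp add: sum.If_cases vimage_def)
  also have "(\<Sum>a\<in>emb -` Y. vchar b a) = (if Y \<subseteq> perp b then of_nat (card Y) else 0)"
    by (simp add: sum_vchar_subspace subspace_vimage_emb Bq_subspace[OF Y] subset_perp_iff[OF Y]
        card_vimage_emb[OF Y])
  finally show ?thesis by simp
qed

lemma ip_hat_proj:
  fixes b :: "'a::{field,finite} ^ 'n::finite"
  assumes u: "u \<in> weight_space H_group H_act M (H_char b)" and X: "X \<in> Bq Fqn"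
  shows "ip u (hat_proj b X) = of_nat (CARD('a) ^ CARD('n)) * u $ hat X"
proof -
  have "vchar b a * u $ translate a (hat X) = u $ hat X" for a
    using H_act_nth_translate[OF hat_in_Aq[OF X], of a u] u
    by (simp add: mem_weight_space_H_char)
  then show ?thesis
    by (simp add: hat_proj_eq_sum[OF X] ip_sum_right ip_scale_right ip_bvec_right cnj_add_char)
qed

lemma ip_hat_proj_hat_proj:
  fixes b :: "'a::{field,finite} ^ 'n::finite"
  assumes "X \<in> Bq Fqn" "Y \<in> Bq Fqn"
  shows "ip (hat_proj b Y) (hat_proj b X) =
    (if X = Y \<and> Y \<subseteq> perp b then of_nat (CARD('a) ^ CARD('n) * card Y) else 0)"
proof -
  have "hat_proj b Y \<in> weight_space H_group H_act UNIV (H_char b)"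
    by (simp add: mem_weight_space_H_char H_act_char_proj)
  from ip_hat_proj[OF this assms(1)] show ?thesis by (simp add: hat_proj_nth_hat[OF assms])
qed

lemma Bq_nonempty: "Y \<in> Bq X \<Longrightarrow> Y \<noteq> {}"
  using vec.subspace_0 by (auto simp: Bq_def)

lemma hat_proj_eq_0_iff:
  assumes "Y \<in> Bq Fqn"
  shows "hat_proj b Y = 0 \<longleftrightarrow> \<not> Y \<subseteq> perp b"
  using Bq_nonempty[OF assms] ip_hat_proj_hat_proj[OF assms assms, of b]
  by (simp flip: ip_self_eq_0_iff)

lemma orthogonal_on_scaled_hat_proj:
  "T \<subseteq> Bq Fqn \<Longrightarrow> orthogonal_on T (\<lambda>Y. c Y *s hat_proj b Y)"
  by (auto simp: orthogonal_on_def pairwise_def ip_scale_left ip_scale_right ip_hat_proj_hat_proj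
      subset_iff)

lemma hat_proj_basis_W_rank:
  fixes b :: "'a::{field,finite} ^ 'n::finite"
  assumes "1 \<le> k"
  defines "B \<equiv> {hat_proj b X | X. X \<in> rank_part (Bq Fqn) (k - 1) \<and> hat_proj b X \<noteq> 0}"
  shows "vec.independent B \<and> vec.span B = W_rank (H_char b) k"
proof
  let ?T = "{X \<in> rank_part (Bq Fqn) (k - 1). hat_proj b X \<noteq> 0}"
  have "?T \<subseteq> Bq Fqn" by (auto simp: rank_part_def)
  then have "orthogonal_on ?T (hat_proj b)"
    using orthogonal_on_scaled_hat_proj[where c = "\<lambda>_. 1"] by simp
  then have "vec.independent (hat_proj b ` ?T)" by (rule independent_orthogonal) simp
  moreover have "B = hat_proj b ` ?T" by (auto simp: B_def)
  ultimately show "vec.independent B" by simp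
  have "B = hat_proj b ` rank_part (Bq Fqn) (k - 1) - {0}" by (auto simp: B_def)
  then show "vec.span B = W_rank (H_char b) k" using assms(1) W_rank_H_char[of b "k - 1"] by simp
qed

lemma covers_in_memD: "covers_in P Z Y \<Longrightarrow> Z \<in> P"
  by (simp add: covers_in_def)

lemma hat_proj_nonzero_covers:
  assumes "covers_in (Bq Fqn) X Y" "hat_proj b X \<noteq> 0"
  shows "hat_proj b Y \<noteq> 0"
  using assms by (auto simp: covers_in_def hat_proj_eq_0_iff)

lemma up_op_bvec_translate_hat:
  assumes Y: "Y \<in> Bq Fqn"
  shows "up_op UNIV (bvec (translate a (hat Y))) =
    (\<Sum>X | covers_in (Bq Fqn) X Y. bvec (translate a (hat X)))"
proof -
  have "inj_on (\<lambda>X. translate a (hat X)) {X. covers_in (Bq Fqn) X Y}"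
    by (rule inj_onI) (metis covers_in_def mem_Collect_eq translate_hat_Int_Fqn)
  moreover have "{Z. covers_in (Bq UNIV) Z (translate a (hat Y))} =
      (\<lambda>X. translate a (hat X)) ` {X. covers_in (Bq Fqn) X Y}"
    using covers_in_translate_hat_iff[OF Y] by auto
  moreover have "translate a (hat Y) \<in> Bq UNIV"
    by (simp add: Bq_def subspace_translate subspace_hat)
  ultimately show ?thesis by (simp add: up_op_bvec sum.reindex)
qed

lemma up_op_hat_proj:
  assumes Y: "Y \<in> Bq (perp b)"
  shows "up_op UNIV (hat_proj b Y) = (\<Sum>X | covers_in (Bq (perp b)) X Y. hat_proj b X)"
proof -
  have YF: "Y \<in> Bq Fqn" using Y by (simp add: Bq_perp)
  have "up_op UNIV (hat_proj b Y) =
      (\<Sum>a\<in>UNIV. vchar b (- a) *s (\<Sum>X | covers_in (Bq Fqn) X Y. bvec (translate a (hat X))))"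
    by (simp add: hat_proj_eq_sum[OF YF] vec.linear_sum[OF linear_up_op]
        vec.linear_scale[OF linear_up_op] up_op_bvec_translate_hat[OF YF])
  also have "\<dots> =
      (\<Sum>X | covers_in (Bq Fqn) X Y. \<Sum>a\<in>UNIV. vchar b (- a) *s bvec (translate a (hat X)))"
    unfolding vec.scale_sum_right by (rule sum.swap)
  also have "\<dots> = (\<Sum>X | covers_in (Bq Fqn) X Y. hat_proj b X)"
    by (intro sum.cong refl) (simp add: covers_in_memD hat_proj_eq_sum)
  also have "\<dots> = (\<Sum>X | covers_in (Bq (perp b)) X Y. hat_proj b X)"
  proof (rule sum.mono_neutral_right)
    show "{X. covers_in (Bq (perp b)) X Y} \<subseteq> {X. covers_in (Bq Fqn) X Y}"
      using perp_subset_Fqn by (auto simp: covers_in_Bq_iff_dim)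
    have "hat_proj b X = 0" if "covers_in (Bq Fqn) X Y" "\<not> covers_in (Bq (perp b)) X Y" for X
    proof -
      have "X \<in> Bq Fqn" using that(1) by (rule covers_in_memD)
      moreover have "\<not> X \<subseteq> perp b" using that by (auto simp: covers_in_Bq_iff_dim)
      ultimately show ?thesis by (simp add: hat_proj_eq_0_iff)
    qed
    then show "\<forall>X\<in>{X. covers_in (Bq Fqn) X Y} - {X. covers_in (Bq (perp b)) X Y}. hat_proj b X = 0"
      by blast
  qed simp
  finally show ?thesis .
qed

section \<open>The up operator on the isotypic components\<close>

definition perp_lift ::
  "'a::{field,finite} ^ 'n::finite \<Rightarrow> (('a ^ 'n option) set \<Rightarrow> complex) \<Rightarrow>
   complex ^ (('a ^ 'n option) set) \<Rightarrow> complex ^ (('a ^ 'n option) set)" where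
  "perp_lift b c = lin_ext (Bq (perp b)) (\<lambda>Y. c Y *s hat_proj b Y)"

lemma linear_perp_lift: "Vector_Spaces.linear (*s) (*s) (perp_lift b c)"
  unfolding perp_lift_def by (rule linear_lin_ext)

lemma bij_betw_perp_lift:
  fixes b :: "'a::{field,finite} ^ 'n::finite"
  assumes nonzero: "\<And>Y. Y \<in> Bq (perp b) \<Longrightarrow> c Y \<noteq> 0"
  shows "bij_betw (perp_lift b c) (free_space (Bq (perp b))) (W_iso (H_char b))"
proof -
  let ?f = "\<lambda>Y. c Y *s hat_proj b Y"
  have "orthogonal_on (Bq (perp b)) ?f"
    by (rule orthogonal_on_scaled_hat_proj) (auto simp: Bq_perp)
  then have "inj_on (perp_lift b c) (free_space (Bq (perp b)))"
    unfolding perp_lift_def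
    by (rule inj_on_lin_ext_orthogonal) (simp add: nonzero Bq_perp[THEN iffD1] hat_proj_eq_0_iff)
  moreover have "perp_lift b c ` free_space (Bq (perp b)) = vec.span (?f ` Bq (perp b))"
    unfolding perp_lift_def by (rule image_lin_ext)
  moreover have "vec.span (?f ` Bq (perp b)) = vec.span (hat_proj b ` Bq Fqn)"
    unfolding vec.span_eq
  proof (intro conjI image_subsetI)
    fix Y :: "('a ^ 'n option) set" assume "Y \<in> Bq (perp b)"
    then show "?f Y \<in> vec.span (hat_proj b ` Bq Fqn)"
      by (intro vec.span_scale vec.span_base imageI) (simp add: Bq_perp)
  next
    fix Y :: "('a ^ 'n option) set" assume Y: "Y \<in> Bq Fqn"
    show "hat_proj b Y \<in> vec.span (?f ` Bq (perp b))"
    proof (cases "Y \<in> Bq (perp b)")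
      case True
      then have "inverse (c Y) *s ?f Y \<in> vec.span (?f ` Bq (perp b))"
        by (intro vec.span_scale vec.span_base imageI)
      then show ?thesis using nonzero[OF True] by simp
    next
      case False
      then show ?thesis using Y hat_proj_eq_0_iff[OF Y, of b] by (simp add: Bq_perp vec.span_zero)
    qed
  qed
  ultimately show ?thesis by (simp add: bij_betw_def W_iso_H_char)
qed

lemma up_op_perp_lift:
  assumes scaling: "\<And>Z Y. covers_in (Bq (perp b)) Z Y \<Longrightarrow> c Y = k * c Z"
  shows "perp_lift b c (k *s up_op (perp b) v) = up_op UNIV (perp_lift b c v)"
proof -
  have "perp_lift b c (k *s up_op (perp b) v) = k *s perp_lift b c (up_op (perp b) v)"
    by (rule vec.linear_scale[OF linear_perp_lift])
  also have "\<dots> =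
      lin_ext (Bq (perp b)) (\<lambda>Y. k *s perp_lift b c (\<Sum>Z | covers_in (Bq (perp b)) Z Y. bvec Z)) v"
    unfolding up_op_def
    by (rule linear_lin_ext_comp) (intro vec.linear_compose_scale_right linear_perp_lift)
  also have "\<dots> = lin_ext (Bq (perp b)) (\<lambda>Y. up_op UNIV (c Y *s hat_proj b Y)) v"
  proof (rule lin_ext_cong)
    fix Y assume Y: "Y \<in> Bq (perp b)"
    have "k *s perp_lift b c (\<Sum>Z | covers_in (Bq (perp b)) Z Y. bvec Z) =
        (\<Sum>Z | covers_in (Bq (perp b)) Z Y. k *s perp_lift b c (bvec Z))"
      by (simp only: vec.linear_sum[OF linear_perp_lift] vec.scale_sum_right)
    also have "\<dots> = (\<Sum>Z | covers_in (Bq (perp b)) Z Y. c Y *s hat_proj b Z)"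
      by (intro sum.cong refl) (simp add: scaling perp_lift_def lin_ext_bvec covers_in_memD)
    also have "\<dots> = up_op UNIV (c Y *s hat_proj b Y)"
      by (simp only: vec.linear_scale[OF linear_up_op] up_op_hat_proj[OF Y] vec.scale_sum_right)
    finally show "k *s perp_lift b c (\<Sum>Z | covers_in (Bq (perp b)) Z Y. bvec Z) =
        up_op UNIV (c Y *s hat_proj b Y)" .
  qed
  also have "\<dots> = up_op UNIV (perp_lift b c v)"
    unfolding perp_lift_def by (rule linear_lin_ext_comp[OF linear_up_op, symmetric])
  finally show ?thesis .
qed

lemma pair_iso_perp_lift:
  assumes nonzero: "\<And>Y. Y \<in> Bq (perp b) \<Longrightarrow> c Y \<noteq> 0"
    and scaling: "\<And>Z Y. covers_in (Bq (perp b)) Z Y \<Longrightarrow> c Y = k * c Z"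
  shows "pair_iso (free_space (Bq (perp b))) (\<lambda>v. k *s up_op (perp b) v)
    (W_iso (H_char b)) (up_op UNIV) (perp_lift b c)"
proof (rule pair_isoI)
  have "linear_map_on (free_space (Bq (perp b))) (\<lambda>v. k *s up_op (perp b) v)"
    by (intro linear_map_on_linear vec.linear_compose_scale_right linear_up_op)
  moreover have "k *s up_op (perp b) v \<in> free_space (Bq (perp b))" for v
    by (intro vec.subspace_scale subspace_free_space up_op_in_free_space)
  ultimately show "operator_on (free_space (Bq (perp b))) (\<lambda>v. k *s up_op (perp b) v)"
    by (auto simp: operator_on_def subspace_free_space)
  show "vec.subspace (W_iso (H_char b))" by (simp add: W_iso_H_char)
qed (simp_all add: linear_map_on_linear linear_up_op linear_perp_lift bij_betw_perp_lift nonzero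
    up_op_perp_lift scaling)

lemma ip_perp_lift:
  fixes b :: "'a::{field,finite} ^ 'n::finite"
  assumes w: "w \<in> free_space (rank_part (Bq (perp b)) k)"
    and v: "v \<in> free_space (rank_part (Bq (perp b)) k)"
    and norm: "\<And>Y. Y \<in> rank_part (Bq (perp b)) k \<Longrightarrow>
      of_nat (CARD('a) ^ (CARD('n) + k)) * (c Y * cnj (c Y)) = r"
  shows "ip (perp_lift b c w) (perp_lift b c v) = r * ip w v"
  unfolding perp_lift_def
    lin_ext_subset[OF rank_part_subset w] lin_ext_subset[OF rank_part_subset v]
proof (rule ip_lin_ext_lin_ext_orthogonal[OF _ _ w])
  fix X assume X: "X \<in> rank_part (Bq (perp b)) k"
  then have "card X = CARD('a) ^ k" using card_subspace[of X] by (simp add: rank_part_def Bq_def)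
  then show "ip (c X *s hat_proj b X) (c X *s hat_proj b X) = r"
    using norm[OF X] X
    by (simp add: rank_part_def Bq_perp ip_scale_left ip_scale_right ip_hat_proj_hat_proj
        power_add mult_ac)
qed (auto simp: rank_part_def Bq_perp intro: orthogonal_on_scaled_hat_proj)

lemma card_translate_hat_fibre:
  assumes Y: "Y \<in> Bq Fqn" and Z: "Z \<in> Aq" "Aq_equiv Z (hat Y)"
  shows "card {a. translate a (hat Y) = Z} = card Y"
proof -
  obtain c where Z_eq: "Z = translate c (hat Y)"
    using Z Aq_eq_translate_hat[of Z] by (auto simp: Aq_equiv_def hat_Int_Fqn[OF Y])
  have "{a. translate a (hat Y) = Z} = (\<lambda>a. c + a) ` (emb -` Y)"
  proof (intro Set.set_eqI iffI)
    fix a assume "a \<in> {a. translate a (hat Y) = Z}"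
    then have "a - c \<in> emb -` Y"
      unfolding Z_eq mem_Collect_eq translate_eq_iff translate_hat_fixed_iff[OF Y Y] by blast
    then show "a \<in> (\<lambda>a. c + a) ` (emb -` Y)" by (rule rev_image_eqI) simp
  qed (auto simp: Z_eq translate_eq_iff translate_hat_fixed_iff[OF Y Y])
  then show ?thesis by (simp add: card_image card_vimage_emb[OF Y])
qed

lemma hat_proj_0_eq_sum_Aq_equiv:
  assumes Y: "Y \<in> Bq Fqn"
  shows "hat_proj 0 Y = of_nat (card Y) *s (\<Sum>Z | Z \<in> Aq \<and> Aq_equiv Z (hat Y). bvec Z)"
proof -
  let ?C = "{Z. Z \<in> Aq \<and> Aq_equiv Z (hat Y)}"
  have "hat_proj 0 Y = (\<Sum>a\<in>UNIV. bvec (translate a (hat Y)))"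
    by (simp add: hat_proj_eq_sum[OF Y])
  also have "\<dots> = (\<Sum>Z\<in>?C. \<Sum>a | a \<in> UNIV \<and> translate a (hat Y) = Z. bvec (translate a (hat Y)))"
    by (rule sum.group[symmetric])
      (simp_all add: image_subset_iff translate_in_Aq hat_in_Aq[OF Y] Aq_equiv_def)
  also have "\<dots> = (\<Sum>Z\<in>?C. of_nat (card Y) *s bvec Z)"
  proof (intro sum.cong refl)
    fix Z assume "Z \<in> ?C"
    have "(\<Sum>a | a \<in> UNIV \<and> translate a (hat Y) = Z. bvec (translate a (hat Y))) =
        (\<Sum>a | translate a (hat Y) = Z. bvec Z)"
      by (intro sum.cong) auto
    also have "\<dots> = of_nat (card Y) *s bvec Z"
      using \<open>Z \<in> ?C\<close>
      by (simp only: vec.sum_constant_scale card_translate_hat_fibre[OF Y] mem_Collect_eq)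
    finally show "(\<Sum>a | a \<in> UNIV \<and> translate a (hat Y) = Z. bvec (translate a (hat Y))) =
        of_nat (card Y) *s bvec Z" .
  qed
  finally show ?thesis by (simp only: vec.scale_sum_right)
qed

lemma theta_eq_perp_lift: "theta v = perp_lift 0 (\<lambda>Y. 1 / of_nat (card Y)) v"
  unfolding theta_def perp_lift_def perp_0
proof (rule lin_ext_cong)
  fix Y :: "('a ^ 'b option) set" assume Y: "Y \<in> Bq Fqn"
  show "(\<Sum>Z | Z \<in> Aq \<and> Aq_equiv Z (hat Y). bvec Z) = (1 / of_nat (card Y)) *s hat_proj 0 Y"
    using Bq_nonempty[OF Y] by (simp add: hat_proj_0_eq_sum_Aq_equiv[OF Y])
qed

lemma pair_iso_theta:
  "pair_iso (free_space (Bq Fqn)) (\<lambda>v. of_nat (CARD('a)) *s up_op Fqn v)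
    (W_iso (H_char 0)) (up_op UNIV)
    (theta :: complex ^ (('a::{field,finite} ^ 'n::finite option) set) \<Rightarrow> _)"
proof -
  have "1 / of_nat (card Y) = (of_nat (CARD('a)) * (1 / of_nat (card Z)) :: complex)"
    if "covers_in (Bq (perp 0)) Z Y" for Z Y :: "('a ^ 'n option) set"
    using that by (simp add: covers_in_Bq_iff_dim card_subspace)
  moreover have "1 / of_nat (card Y) \<noteq> (0 :: complex)" if "Y \<in> Bq (perp 0)"
    for Y :: "('a ^ 'n option) set"
    using Bq_nonempty[OF that] by simp
  ultimately show ?thesis
    unfolding theta_eq_perp_lift[abs_def] perp_0[symmetric] by (intro pair_iso_perp_lift)
qed

lemma ip_theta:
  fixes w v :: "complex ^ (('a::{field,finite} ^ 'n::finite option) set)"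
  assumes "k \<le> CARD('n)"
    and "w \<in> free_space (rank_part (Bq Fqn) k)" "v \<in> free_space (rank_part (Bq Fqn) k)"
  shows "ip (theta w) (theta v) = of_nat (CARD('a)) ^ (CARD('n) - k) * ip w v"
  unfolding theta_eq_perp_lift
proof (rule ip_perp_lift)
  fix Y :: "('a ^ 'n option) set" assume "Y \<in> rank_part (Bq (perp 0)) k"
  then have "card Y = CARD('a) ^ k" using card_subspace[of Y] by (simp add: rank_part_def Bq_def)
  moreover have "CARD('n) + k = (CARD('n) - k) + k + k" using assms(1) by simp
  ultimately show "of_nat (CARD('a) ^ (CARD('n) + k)) *
      (1 / of_nat (card Y) * cnj (1 / of_nat (card Y))) = (of_nat (CARD('a)) ^ (CARD('n) - k) :: complex)"
    by (simp only: power_add) simp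
qed (use assms in \<open>simp_all add: perp_0\<close>)

lemma up_op_UNIV_eq:
  assumes v: "v \<in> free_space (Bq Fqn)"
  shows "up_op UNIV v = up_op Fqn v + theta v"
proof -
  have "up_op UNIV (bvec Y) = (\<Sum>Z | covers_in (Bq Fqn) Z Y. bvec Z) +
      (\<Sum>Z | Z \<in> Aq \<and> Aq_equiv Z (hat Y). bvec Z)"
    if Y: "Y \<in> Bq Fqn" for Y :: "('a ^ 'b option) set"
  proof -
    have "{Z. covers_in (Bq UNIV) Z Y} =
        {Z. covers_in (Bq Fqn) Z Y} \<union> {Z. Z \<in> Aq \<and> Aq_equiv Z (hat Y)}"
      using covers_in_UNIV_iff[OF Y] by (auto simp: Aq_equiv_def hat_Int_Fqn[OF Y])
    moreover have "{Z. covers_in (Bq Fqn) Z Y} \<inter> {Z. Z \<in> Aq \<and> Aq_equiv Z (hat Y)} = {}"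
      by (auto simp: covers_in_def Aq_def)
    moreover have "Y \<in> Bq UNIV" using Y by (simp add: Bq_def)
    ultimately show ?thesis by (simp add: up_op_bvec sum.union_disjoint)
  qed
  then have "up_op UNIV v = lin_ext (Bq Fqn) (\<lambda>Y. (\<Sum>Z | covers_in (Bq Fqn) Z Y. bvec Z) +
      (\<Sum>Z | Z \<in> Aq \<and> Aq_equiv Z (hat Y). bvec Z)) v"
    unfolding linear_eq_lin_ext[OF linear_up_op v] by (rule lin_ext_cong)
  also have "\<dots> = up_op Fqn v + theta v"
    by (simp add: up_op_def theta_def lin_ext_def vec.scale_right_distrib sum.distrib)
  finally show ?thesis .
qed

lemma hat_proj_hyperplane_nonzero_iff:
  fixes b :: "'a::{field,finite} ^ 'n::finite"
  assumes "b \<noteq> 0"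
  shows "X \<in> rank_part (Bq Fqn) (CARD('n) - 1) \<and> hat_proj b X \<noteq> 0 \<longleftrightarrow> X = perp b"
proof
  assume "X \<in> rank_part (Bq Fqn) (CARD('n) - 1) \<and> hat_proj b X \<noteq> 0"
  then have X: "X \<in> Bq Fqn" "vec.dim X = CARD('n) - 1" "X \<subseteq> perp b"
    by (auto simp: rank_part_def hat_proj_eq_0_iff)
  then show "X = perp b"
    using vec.subspace_dim_equal[OF Bq_subspace[OF X(1)] Bq_subspace[OF perp_in_Bq]]
      dim_perp[OF assms] by simp
qed (simp add: rank_part_def perp_in_Bq dim_perp[OF assms] hat_proj_eq_0_iff)

lemma dim_W_rank_hyperplane:
  fixes b :: "'a::{field,finite} ^ 'n::finite"
  assumes "b \<noteq> 0"
  shows "vec.dim (W_rank (H_char b) CARD('n)) = 1"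
proof -
  have "{hat_proj b X | X. X \<in> rank_part (Bq Fqn) (CARD('n) - 1) \<and> hat_proj b X \<noteq> 0} =
      {hat_proj b (perp b)}"
    using hat_proj_hyperplane_nonzero_iff[OF assms] by auto
  then have "hat_proj b (perp b) \<noteq> 0" "W_rank (H_char b) CARD('n) = vec.span {hat_proj b (perp b)}"
    using hat_proj_basis_W_rank[of "CARD('n)" b] by (simp_all add: Suc_leI)
  then show ?thesis by simp
qed

lemma lambda_map_perp: "lambda_map (H_char b) (perp b) = perp_lift b (\<lambda>_. 1)"
  by (simp add: lambda_map_def perp_lift_def)

lemma pair_iso_lambda_map:
  "pair_iso (free_space (Bq (perp b))) (up_op (perp b)) (W_iso (H_char b)) (up_op UNIV)
    (lambda_map (H_char b) (perp b))"
  using pair_iso_perp_lift[of b "\<lambda>_. 1" 1] by (simp add: lambda_map_perp)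

lemma ip_lambda_map:
  fixes b :: "'a::{field,finite} ^ 'n::finite"
  assumes "w \<in> free_space (rank_part (Bq (perp b)) k)" "v \<in> free_space (rank_part (Bq (perp b)) k)"
  shows "ip (lambda_map (H_char b) (perp b) w) (lambda_map (H_char b) (perp b) v) =
    of_nat (CARD('a)) ^ (CARD('n) + k) * ip w v"
  unfolding lambda_map_perp by (rule ip_perp_lift[OF assms]) simp

lemma card_H_char_hat_proj_nonzero:
  fixes X :: "('a::{field,finite} ^ 'n::finite option) set"
  assumes "X \<in> rank_part (Bq Fqn) (CARD('n) - 1)"
  shows "card {\<psi> \<in> range H_char. \<psi> \<noteq> H_char 0 \<and> char_proj \<psi> (bvec (hat X)) \<noteq> 0} = CARD('a) - 1"
proof -
  have X: "X \<in> Bq Fqn" and dim: "vec.dim X = CARD('n) - 1"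
    using assms by (simp_all add: rank_part_def)
  let ?P = "annihilator (emb -` X)"
  have "{\<psi> \<in> range H_char. \<psi> \<noteq> H_char 0 \<and> char_proj \<psi> (bvec (hat X)) \<noteq> 0} = H_char ` (?P - {0})"
    using hat_proj_eq_0_iff[OF X] subset_perp_iff[OF X] by (auto dest: H_char_inj)
  moreover have "card (H_char ` (?P - {0})) = card (?P - {0})"
    by (rule card_image) (auto simp: inj_on_def dest: H_char_inj)
  moreover have "card ?P * card X = CARD('a) ^ CARD('n)"
    using card_annihilator_mult_card[OF subspace_vimage_emb[OF Bq_subspace[OF X]]]
      card_vimage_emb[OF X] by simp
  then have "card ?P * CARD('a) ^ (CARD('n) - 1) = CARD('a) * CARD('a) ^ (CARD('n) - 1)"
    using card_subspace[OF Bq_subspace[OF X]] dim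
    by (metis Suc_pred' power_Suc zero_less_card_finite)
  then have "card ?P = CARD('a)" by simp
  moreover have "card (?P - {0}) = card ?P - 1"
    by (rule card_Diff_singleton) (simp add: annihilator_def)
  ultimately show ?thesis by simp
qed

theorem theorem2p5:
  fixes q n :: nat
    and Irr :: "('a::{field,finite} ^ 'n::finite option ^ 'n option \<Rightarrow> complex) set"
    and triv :: "'a ^ 'n option ^ 'n option \<Rightarrow> complex"
    and En :: "('a ^ 'n option) set"
  assumes q: "q = CARD('a)"
    and n: "n = CARD('n)"
    and Irr: "Irr = irr_chars H_group"
    and triv: "triv = trivial_char H_group"
    and En: "En = Fqn"
  shows
    \<comment> \<open>(i)\<close>
    "(\<forall>\<psi>\<in>Irr. \<forall>X\<in>Aq. \<forall>Y\<in>Aq. Aq_equiv X Y \<longrightarrow>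
        (\<exists>c. c \<noteq> 0 \<and> char_proj \<psi> (bvec X) = c *s char_proj \<psi> (bvec Y)))
     \<and>
     \<comment> \<open>(ii)\<close>
     (\<forall>\<psi>\<in>Irr. \<forall>k. 1 \<le> k \<and> k \<le> n + 1 \<longrightarrow>
        (let B = {char_proj \<psi> (bvec (hat X)) | X. X \<in> rank_part (Bq En) (k - 1) \<and> char_proj \<psi> (bvec (hat X)) \<noteq> 0}
         in vec.independent B \<and> vec.span B = W_rank \<psi> k))
     \<and>
     \<comment> \<open>(iii)\<close>
     (\<forall>\<psi>\<in>Irr. \<forall>X\<in>Bq En. \<forall>Y\<in>Bq En. covers_in (Bq En) X Y \<longrightarrow>
        char_proj \<psi> (bvec (hat X)) \<noteq> 0 \<longrightarrow> char_proj \<psi> (bvec (hat Y)) \<noteq> 0)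
     \<and>
     \<comment> \<open>(iv)\<close>
     (pair_iso (free_space (Bq En)) (\<lambda>v. of_nat q *s up_op En v) (W_iso triv) (up_op UNIV) theta \<and>
      (\<forall>v\<in>free_space (Bq En). up_op UNIV v = up_op En v + theta v) \<and>
      (\<forall>k\<le>n. \<forall>w\<in>free_space (rank_part (Bq En) k). \<forall>v\<in>free_space (rank_part (Bq En) k).
         ip (theta w) (theta v) = of_nat q ^ (n - k) * ip w v))
     \<and>
     \<comment> \<open>(v)\<close>
     (\<forall>\<psi>\<in>Irr. \<psi> \<noteq> triv \<longrightarrow>
        vec.dim (W_rank \<psi> n) = 1 \<and>
        (\<exists>!X. X \<in> rank_part (Bq En) (n - 1) \<and> char_proj \<psi> (bvec (hat X)) \<noteq> 0) \<and>
        (\<forall>X. X \<in> rank_part (Bq En) (n - 1) \<and> char_proj \<psi> (bvec (hat X)) \<noteq> 0 \<longrightarrow>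
           pair_iso (free_space (Bq X)) (up_op X) (W_iso \<psi>) (up_op UNIV) (lambda_map \<psi> X) \<and>
           (\<forall>k\<le>n - 1. \<forall>w\<in>free_space (rank_part (Bq X) k). \<forall>v\<in>free_space (rank_part (Bq X) k).
              ip (lambda_map \<psi> X w) (lambda_map \<psi> X v) = of_nat q ^ (n + k) * ip w v)))
     \<and>
     \<comment> \<open>(vi)\<close>
     (\<forall>X\<in>rank_part (Bq En) (n - 1).
        card {\<psi> \<in> Irr. \<psi> \<noteq> triv \<and> char_proj \<psi> (bvec (hat X)) \<noteq> 0} = q - 1)"
  unfolding q n Irr triv En irr_chars_H_group trivial_char_H_group
proof (intro conjI, goal_cases)
  case 1
  show ?case using char_proj_Aq_equiv by blast
next
  case 2
  show ?case unfolding Let_def using hat_proj_basis_W_rank by blast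
next
  case 3
  show ?case using hat_proj_nonzero_covers by blast
next
  case 4
  show ?case by (rule pair_iso_theta)
next
  case 7
  show ?case
  proof (intro ballI impI, elim rangeE, goal_cases)
    case (1 \<psi> b)
    then have "b \<noteq> 0" by blast
    show ?case
      unfolding \<open>\<psi> = H_char b\<close> hat_proj_hyperplane_nonzero_iff[OF \<open>b \<noteq> 0\<close>]
      using dim_W_rank_hyperplane[OF \<open>b \<noteq> 0\<close>] pair_iso_lambda_map[of b] by (simp add: ip_lambda_map)
  qed
qed (use up_op_UNIV_eq ip_theta card_H_char_hat_proj_nonzero in blast)+

end
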